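(* Let $(L|K,v)$ be a finite extension of valued fields with $Lv|Kv$ separable of degree $[Lv:Kv]=[L:K]$. Then $\mathcal{O}_L=\mathcal{O}_K[x]$ for some $x\in L$ with $vx=0$ and $Lv=Kv(xv)$, and we have $$\Omega_{\mathcal{O}_L|\mathcal{O}_K}=0.$$
   Context: Valuations are Krull valuations of arbitrary rank. $(L|K,v)$ denotes a field extension $L|K$ with a valuation $v$ on $L$, $K$ being endowed with the restriction of $v$. $\mathcal{O}_K,\mathcal{O}_L$ are the valuation rings, $Kv,Lv$ the residue fields, $vx$ the value and $xv$ the residue of an element $x$. $\Omega_{B|A}$ is the module of relative Kähler differentials of an $A$-algebra $B$. *)

theory Defs
  imports "HOL-Algebra.Algebra" "HOL-Library.Extended"
begin

section \<open>Krull valuations, valuation rings and residue fields\<close>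

text \<open>
  The value group is (contained in) an arbitrary linearly ordered abelian group \<open>'g\<close>, extended by
  a top element \<open>\<infinity>\<close>, the value of zero. The library type \<^typ>\<open>'g extended\<close> also has a bottom
  element \<open>-\<infinity>\<close>, which has to be excluded as a value.
\<close>

locale valued_field = field L for L :: "('a, 'm) ring_scheme" (structure) +
  fixes v :: "'a \<Rightarrow> 'g::linordered_ab_group_add extended"
  assumes val_neq_Minf: "x \<in> carrier L \<Longrightarrow> v x \<noteq> -\<infinity>"
    and val_eq_Pinf_iff: "x \<in> carrier L \<Longrightarrow> v x = \<infinity> \<longleftrightarrow> x = \<zero>"
    and val_mult: "\<lbrakk> x \<in> carrier L; y \<in> carrier L \<rbrakk> \<Longrightarrow> v (x \<otimes> y) = v x + v y"
    and val_add: "\<lbrakk> x \<in> carrier L; y \<in> carrier L \<rbrakk> \<Longrightarrow> min (v x) (v y) \<le> v (x \<oplus> y)"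

text \<open>
  For a subfield \<open>K\<close> of \<open>L\<close> with the restricted valuation, the valuation ring of \<open>K\<close> is
  \<open>valuation_ring (L\<lparr>carrier := K\<rparr>) v\<close>.
\<close>

definition valuation_ring :: "('a, 'm) ring_scheme \<Rightarrow> ('a \<Rightarrow> 'g::linordered_ab_group_add extended) \<Rightarrow> 'a set"
  where "valuation_ring L v = {x \<in> carrier L. 0 \<le> v x}"

definition valuation_ideal :: "('a, 'm) ring_scheme \<Rightarrow> ('a \<Rightarrow> 'g::linordered_ab_group_add extended) \<Rightarrow> 'a set"
  where "valuation_ideal L v = {x \<in> carrier L. 0 < v x}"

definition residue_field ::
    "('a, 'm) ring_scheme \<Rightarrow> ('a \<Rightarrow> 'g::linordered_ab_group_add extended) \<Rightarrow> 'a set ring"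
  where "residue_field L v = (L\<lparr>carrier := valuation_ring L v\<rparr>) Quot (valuation_ideal L v)"

definition residue_class ::
    "('a, 'm) ring_scheme \<Rightarrow> ('a \<Rightarrow> 'g::linordered_ab_group_add extended) \<Rightarrow> 'a \<Rightarrow> 'a set"
  where "residue_class L v x = valuation_ideal L v +>\<^bsub>L\<lparr>carrier := valuation_ring L v\<rparr>\<^esub> x"

text \<open>
  The residue field of a subfield \<open>K\<close> of \<open>L\<close>, identified as usual with its image under the
  canonical embedding into the residue field of \<open>L\<close>; see \<open>residue_subfield_iso\<close> below.
\<close>

definition residue_subfield ::
    "('a, 'm) ring_scheme \<Rightarrow> ('a \<Rightarrow> 'g::linordered_ab_group_add extended) \<Rightarrow> 'a set \<Rightarrow> 'a set set"
  where "residue_subfield L v K = residue_class L v ` valuation_ring (L\<lparr>carrier := K\<rparr>) v"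

context valued_field
begin

lemma val_zero: "v \<zero> = \<infinity>"
  using val_eq_Pinf_iff[of \<zero>] by simp

lemma val_finE:
  assumes "x \<in> carrier L" "x \<noteq> \<zero>"
  obtains g where "v x = Fin g"
  using assms val_neq_Minf[of x] val_eq_Pinf_iff[of x] by (cases "v x") auto

lemma val_one: "v \<one> = 0"
proof -
  obtain g where g: "v \<one> = Fin g"
    using val_finE[of \<one>] by auto
  have "v \<one> = v \<one> + v \<one>"
    using val_mult[of \<one> \<one>] by simp
  then show ?thesis
    by (simp add: g zero_extended_def)
qed

lemma val_uminus:
  assumes x: "x \<in> carrier L"
  shows "v (\<ominus> x) = v x"
proof -
  have nz: "\<ominus> \<one> \<noteq> \<zero>"
    using add.inv_eq_1_iff[of \<one>] by (simp add: a_inv_def)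
  obtain g where g: "v (\<ominus> \<one>) = Fin g"
    using val_finE[OF _ nz] by auto
  have "\<ominus> \<one> \<otimes> \<ominus> \<one> = \<one>"
    by (simp add: l_minus)
  then have "g + g = 0"
    using val_mult[of "\<ominus> \<one>" "\<ominus> \<one>"] by (simp add: g val_one zero_extended_def)
  then have "v (\<ominus> \<one>) = 0"
    using g by (simp add: zero_extended_def)
  moreover have "\<ominus> x = \<ominus> \<one> \<otimes> x"
    using x by (simp add: l_minus)
  ultimately show ?thesis
    using val_mult[of "\<ominus> \<one>" x] x by simp
qed

lemma val_inv:
  assumes "x \<in> carrier L" "v x = 0"
  shows "inv x \<in> carrier L" "v (inv x) = 0" "inv x \<otimes> x = \<one>"
proof -
  have nz: "x \<noteq> \<zero>"
    using assms val_zero by (auto simp: zero_extended_def)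
  then have x: "x \<in> Units L"
    using assms by (simp add: field_Units)
  then show "inv x \<in> carrier L" "inv x \<otimes> x = \<one>"
    by simp_all
  then show "v (inv x) = 0"
    using val_mult[of "inv x" x] assms by (simp add: val_one)
qed

lemma val_restrict:
  assumes "subfield K L"
  shows "valued_field (L\<lparr>carrier := K\<rparr>) v"
proof -
  interpret K: field "L\<lparr>carrier := K\<rparr>"
    using subfield_iff(2)[OF assms] .
  have "K \<subseteq> carrier L"
    using subfieldE(3)[OF assms] .
  then show ?thesis
    by unfold_locales (auto simp: val_neq_Minf val_eq_Pinf_iff val_mult val_add subset_iff)
qed

lemma subring_valuation_ring: "subring (valuation_ring L v) L"
proof (rule subringI)
  show "h1 \<otimes> h2 \<in> valuation_ring L v"
    if "h1 \<in> valuation_ring L v" "h2 \<in> valuation_ring L v" for h1 h2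
    using that add_mono[of 0 "v h1" 0 "v h2"] by (simp add: valuation_ring_def val_mult)
  show "h1 \<oplus> h2 \<in> valuation_ring L v"
    if "h1 \<in> valuation_ring L v" "h2 \<in> valuation_ring L v" for h1 h2
    using that val_add[of h1 h2] by (auto simp: valuation_ring_def min_le_iff_disj)
qed (auto simp: valuation_ring_def val_one val_uminus)

lemma cring_valuation_ring: "cring (L\<lparr>carrier := valuation_ring L v\<rparr>)"
  using subcring_iff[of "valuation_ring L v"] subcringI'[OF subring_valuation_ring]
  by (auto simp: valuation_ring_def)

lemma valuation_ideal_maximal:
  "maximalideal (valuation_ideal L v) (L\<lparr>carrier := valuation_ring L v\<rparr>)"
proof -
  let ?O = "L\<lparr>carrier := valuation_ring L v\<rparr>" and ?m = "valuation_ideal L v"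
  interpret O: cring ?O
    by (rule cring_valuation_ring)
  have pos: "0 < a + b" if "0 < a" "0 \<le> b" for a b :: "'g extended"
    using that by (cases a; cases b) (auto simp: zero_extended_def add_pos_nonneg)
  have sub: "?m \<subseteq> carrier ?O"
    by (auto simp: valuation_ideal_def valuation_ring_def)
  have "subgroup ?m (add_monoid ?O)"
  proof (rule O.add.subgroupI)
    show "?m \<noteq> {}"
      by (auto simp: valuation_ideal_def val_zero zero_extended_def intro!: exI[of _ \<zero>])
    show "\<ominus>\<^bsub>?O\<^esub> a \<in> ?m" if "a \<in> ?m" for a
    proof -
      have "\<ominus> a \<in> ?m" "a \<in> ?m"
        using that by (auto simp: valuation_ideal_def val_uminus)
      then have "\<ominus>\<^bsub>?O\<^esub> a = \<ominus> a"
        using sub by (intro O.minus_equality) (auto simp: valuation_ideal_def l_neg)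
      with \<open>\<ominus> a \<in> ?m\<close> show ?thesis
        by simp
    qed
    show "a \<oplus>\<^bsub>?O\<^esub> b \<in> ?m" if "a \<in> ?m" "b \<in> ?m" for a b
      using that val_add[of a b] less_le_trans[of 0 "min (v a) (v b)" "v (a \<oplus> b)"]
      by (auto simp: valuation_ideal_def)
  qed (use sub in auto)
  then have ideal: "ideal ?m ?O"
  proof (rule idealI[OF O.ring_axioms])
    show "x \<otimes>\<^bsub>?O\<^esub> a \<in> ?m" "a \<otimes>\<^bsub>?O\<^esub> x \<in> ?m" if "a \<in> ?m" "x \<in> carrier ?O" for a x
      using that pos[of "v a" "v x"]
      by (auto simp: valuation_ideal_def valuation_ring_def val_mult add.commute)
  qed
  show ?thesis
  proof (rule maximalidealI[OF ideal])
    show "carrier ?O \<noteq> ?m"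
      using val_one by (auto simp: valuation_ideal_def valuation_ring_def set_eq_iff intro!: exI[of _ \<one>])
    show "J = ?m \<or> J = carrier ?O" if J: "ideal J ?O" "?m \<subseteq> J" "J \<subseteq> carrier ?O" for J
    proof (rule disjCI)
      assume "J \<noteq> carrier ?O"
      have "v x \<noteq> 0" if "x \<in> J" for x
      proof
        assume v: "v x = 0"
        have x: "x \<in> carrier L"
          using that J by (auto simp: valuation_ring_def)
        note inv = val_inv[OF x v]
        have "inv x \<otimes>\<^bsub>?O\<^esub> x \<in> J"
          using inv that by (intro ideal.I_l_closed[OF J(1)]) (auto simp: valuation_ring_def)
        then have "\<one>\<^bsub>?O\<^esub> \<in> J"
          using inv by simp
        then show False
          using ideal.one_imp_carrier[OF J(1)] \<open>J \<noteq> carrier ?O\<close> by simp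
      qed
      then have "J \<subseteq> ?m"
        using J(3) by (fastforce simp: valuation_ring_def valuation_ideal_def order_less_le)
      then show "J = ?m"
        using J(2) by blast
    qed
  qed
qed

lemma field_residue_field: "field (residue_field L v)"
  unfolding residue_field_def
  using maximalideal.quotient_is_field[OF valuation_ideal_maximal cring_valuation_ring] .

lemma residue_subfield_iso:
  assumes K: "subfield K L"
  shows "residue_field (L\<lparr>carrier := K\<rparr>) v \<simeq>
    (residue_field L v)\<lparr>carrier := residue_subfield L v K\<rparr>"
proof -
  let ?O = "L\<lparr>carrier := valuation_ring L v\<rparr>" and ?m = "valuation_ideal L v"
  let ?OK = "valuation_ring (L\<lparr>carrier := K\<rparr>) v"
  interpret O: cring ?O
    by (rule cring_valuation_ring)
  interpret m: maximalideal ?m ?O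
    by (rule valuation_ideal_maximal)
  interpret VK: valued_field "L\<lparr>carrier := K\<rparr>" v
    by (rule val_restrict[OF K])
  interpret OK: cring "L\<lparr>carrier := ?OK\<rparr>"
    using VK.cring_valuation_ring by simp
  have K_sub: "K \<subseteq> carrier L"
    using subfieldE(3)[OF K] .
  have OK_sub: "?OK \<subseteq> valuation_ring L v"
    using K_sub by (auto simp: valuation_ring_def)
  have hom: "residue_class L v \<in> ring_hom ?O (residue_field L v)"
    using m.rcos_ring_hom by (simp add: residue_class_def[abs_def] residue_field_def)
  have "residue_class L v \<in> ring_hom (L\<lparr>carrier := ?OK\<rparr>) (residue_field L v)"
    using hom OK_sub by (auto simp: ring_hom_def Pi_iff subset_iff)
  then interpret h: ring_hom_ring "L\<lparr>carrier := ?OK\<rparr>" "residue_field L v" "residue_class L v"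
    using field_residue_field
    by (intro ring_hom_ringI2 OK.ring_axioms) (auto simp: field_def domain_def cring_def)
  have "a_kernel (L\<lparr>carrier := ?OK\<rparr>) (residue_field L v) (residue_class L v)
      = valuation_ideal (L\<lparr>carrier := K\<rparr>) v"
  proof -
    have "residue_class L v x = \<zero>\<^bsub>residue_field L v\<^esub> \<longleftrightarrow> x \<in> ?m" if "x \<in> ?OK" for x
      using that OK_sub O.a_coset_join2[of x ?m] m.a_subgroup m.a_rcos_self[of x]
      by (auto simp: residue_class_def residue_field_def FactRing_def subset_iff)
    then have "a_kernel (L\<lparr>carrier := ?OK\<rparr>) (residue_field L v) (residue_class L v)
        = {x \<in> ?OK. x \<in> ?m}"
      unfolding a_kernel_def' by auto
    also have "\<dots> = valuation_ideal (L\<lparr>carrier := K\<rparr>) v"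
      using K_sub by (auto simp: valuation_ring_def valuation_ideal_def)
    finally show ?thesis .
  qed
  then have "residue_field (L\<lparr>carrier := K\<rparr>) v =
      (L\<lparr>carrier := ?OK\<rparr>) Quot a_kernel (L\<lparr>carrier := ?OK\<rparr>) (residue_field L v) (residue_class L v)"
    unfolding residue_field_def[of "L\<lparr>carrier := K\<rparr>"] by simp
  moreover have "(L\<lparr>carrier := ?OK\<rparr>) Quot a_kernel (L\<lparr>carrier := ?OK\<rparr>) (residue_field L v) (residue_class L v) \<simeq>
      (residue_field L v)\<lparr>carrier := residue_subfield L v K\<rparr>"
    using h.FactRing_iso_set_aux unfolding is_ring_iso_def residue_subfield_def by auto
  ultimately show ?thesis
    by (simp only:)
qed

end


section \<open>Separable field extensions\<close>

text \<open>
  Polynomials of \<open>HOL-Algebra\<close> are lists of coefficients with the leading coefficient first.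
\<close>

definition (in ring) poly_deriv :: "'a list \<Rightarrow> 'a list"
  where "poly_deriv p = normalize (map (\<lambda>i. [i] \<cdot> coeff p i) (rev [1..<length p]))"

definition (in ring) separable_poly :: "'a set \<Rightarrow> 'a list \<Rightarrow> bool"
  where "separable_poly K p \<longleftrightarrow>
    (\<forall>d \<in> carrier (K[X]). d divides\<^bsub>K[X]\<^esub> p \<longrightarrow> d divides\<^bsub>K[X]\<^esub> poly_deriv p \<longrightarrow> d \<in> Units (K[X]))"

definition (in ring) separable_extension :: "'a set \<Rightarrow> 'a set \<Rightarrow> bool"
  where "separable_extension K E \<longleftrightarrow>
    (\<forall>a \<in> E. (algebraic over K) a \<and> separable_poly K (Irr K a))"


section \<open>Kaehler differentials\<close>

text \<open>
  In the module records below the fields \<open>mult\<close> and \<open>one\<close>, which \<^locale>\<open>module\<close> does not use,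
  are left unspecified.
\<close>

definition free_module :: "('a, 'm) ring_scheme \<Rightarrow> 'i set \<Rightarrow> ('a, 'i \<Rightarrow> 'a) module"
  where "free_module R S =
    \<lparr> carrier = {f. (\<forall>i \<in> S. f i \<in> carrier R) \<and> (\<forall>i. i \<notin> S \<longrightarrow> f i = \<zero>\<^bsub>R\<^esub>) \<and> finite {i. f i \<noteq> \<zero>\<^bsub>R\<^esub>}},
      monoid.mult = undefined, one = undefined,
      ring.zero = (\<lambda>i. \<zero>\<^bsub>R\<^esub>), add = (\<lambda>f g i. f i \<oplus>\<^bsub>R\<^esub> g i),
      smult = (\<lambda>a f i. a \<otimes>\<^bsub>R\<^esub> f i) \<rparr>"

definition free_basis :: "('a, 'm) ring_scheme \<Rightarrow> 'i \<Rightarrow> 'i \<Rightarrow> 'a"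
  where "free_basis R i = (\<lambda>j. if j = i then \<one>\<^bsub>R\<^esub> else \<zero>\<^bsub>R\<^esub>)"

definition generated_submodule ::
    "('a, 'm) ring_scheme \<Rightarrow> ('a, 'b, 'n) module_scheme \<Rightarrow> 'b set \<Rightarrow> 'b set"
  where "generated_submodule R M S = \<Inter>{N. submodule N R M \<and> S \<subseteq> N}"

definition quotient_module ::
    "('a, 'b, 'n) module_scheme \<Rightarrow> 'b set \<Rightarrow> ('a, 'b set) module"
  where "quotient_module M N =
    \<lparr> carrier = a_rcosets\<^bsub>M\<^esub> N, monoid.mult = undefined, one = undefined,
      ring.zero = N, add = set_add M,
      smult = (\<lambda>a C. \<Union>x \<in> C. N +>\<^bsub>M\<^esub> (a \<odot>\<^bsub>M\<^esub> x)) \<rparr>"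

text \<open>
  \<open>\<Omega>\<close> of a commutative ring \<open>B\<close> over a subring \<open>A\<close>: the \<open>B\<close>-module generated by symbols \<open>d b\<close>,
  \<open>b \<in> B\<close>, subject to additivity, the Leibniz rule and \<open>d a = 0\<close> for \<open>a \<in> A\<close>.
\<close>

definition kaehler_relations :: "('a, 'm) ring_scheme \<Rightarrow> 'a set \<Rightarrow> ('a \<Rightarrow> 'a) set"
  where "kaehler_relations B A =
    (let M = free_module B (carrier B); \<delta> = free_basis B in
      {\<delta> (b \<oplus>\<^bsub>B\<^esub> c) \<ominus>\<^bsub>M\<^esub> (\<delta> b \<oplus>\<^bsub>M\<^esub> \<delta> c) | b c. b \<in> carrier B \<and> c \<in> carrier B} \<union>
      {\<delta> (b \<otimes>\<^bsub>B\<^esub> c) \<ominus>\<^bsub>M\<^esub> (b \<odot>\<^bsub>M\<^esub> \<delta> c \<oplus>\<^bsub>M\<^esub> c \<odot>\<^bsub>M\<^esub> \<delta> b) | b c. b \<in> carrier B \<and> c \<in> carrier B} \<union>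
      {\<delta> a | a. a \<in> A})"

definition kaehler_submodule :: "('a, 'm) ring_scheme \<Rightarrow> 'a set \<Rightarrow> ('a \<Rightarrow> 'a) set"
  where "kaehler_submodule B A =
    generated_submodule B (free_module B (carrier B)) (kaehler_relations B A)"

definition kaehler_differentials ::
    "('a, 'm) ring_scheme \<Rightarrow> 'a set \<Rightarrow> ('a, ('a \<Rightarrow> 'a) set) module"
  where "kaehler_differentials B A =
    quotient_module (free_module B (carrier B)) (kaehler_submodule B A)"

definition kaehler_d :: "('a, 'm) ring_scheme \<Rightarrow> 'a set \<Rightarrow> 'a \<Rightarrow> ('a \<Rightarrow> 'a) set"
  where "kaehler_d B A b =
    kaehler_submodule B A +>\<^bsub>free_module B (carrier B)\<^esub> free_basis B b"

lemma (in cring) free_module_module: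
  fixes S :: "'i set"
  shows "module R (free_module R S)"
proof (rule moduleI)
  have fin: "finite {i. f i \<oplus> g i \<noteq> \<zero>}"
    if "finite {i. f i \<noteq> \<zero>}" "finite {i. g i \<noteq> \<zero>}" for f g :: "'i \<Rightarrow> 'a"
    by (rule finite_subset[OF _ finite_UnI[OF that]]) auto
  have fin': "finite {i. c \<otimes> f i \<noteq> \<zero>}"
    if "finite {i. f i \<noteq> \<zero>}" "c \<in> carrier R" for c and f :: "'i \<Rightarrow> 'a"
    by (rule finite_subset[OF _ that(1)]) (use that in auto)
  let ?M = "free_module R S"
  have val: "f i \<in> carrier R" if "f \<in> carrier ?M" for f i
    using that by (cases "i \<in> S") (auto simp: free_module_def)
  have ops: "f \<oplus>\<^bsub>?M\<^esub> g = (\<lambda>i. f i \<oplus> g i)" "\<zero>\<^bsub>?M\<^esub> = (\<lambda>i. \<zero>)"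
    "c \<odot>\<^bsub>?M\<^esub> f = (\<lambda>i. c \<otimes> f i)" for f g :: "'i \<Rightarrow> 'a" and c
    by (simp_all add: free_module_def)
  show "abelian_group ?M"
  proof (rule abelian_groupI)
    fix f assume f: "f \<in> carrier ?M"
    show "f \<oplus>\<^bsub>?M\<^esub> g \<in> carrier ?M" if "g \<in> carrier ?M" for g
      using f that fin[of f g] by (simp add: free_module_def)
    show "(f \<oplus>\<^bsub>?M\<^esub> g) \<oplus>\<^bsub>?M\<^esub> h = f \<oplus>\<^bsub>?M\<^esub> (g \<oplus>\<^bsub>?M\<^esub> h)"
      if "g \<in> carrier ?M" "h \<in> carrier ?M" for g h
      using val[OF f] val[OF that(1)] val[OF that(2)] by (simp add: ops a_assoc)
    show "f \<oplus>\<^bsub>?M\<^esub> g = g \<oplus>\<^bsub>?M\<^esub> f" if "g \<in> carrier ?M" for g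
      using val[OF f] val[OF that] by (simp add: ops a_comm)
    show "\<zero>\<^bsub>?M\<^esub> \<oplus>\<^bsub>?M\<^esub> f = f"
      using val[OF f] by (simp add: ops)
    show "\<exists>g \<in> carrier ?M. g \<oplus>\<^bsub>?M\<^esub> f = \<zero>\<^bsub>?M\<^esub>"
    proof (rule bexI)
      show "(\<lambda>i. \<ominus> f i) \<oplus>\<^bsub>?M\<^esub> f = \<zero>\<^bsub>?M\<^esub>"
        using val[OF f] by (simp add: ops l_neg)
      have "finite {i. \<ominus> f i \<noteq> \<zero>}"
        by (rule finite_subset[of _ "{i. f i \<noteq> \<zero>}"]) (use f in \<open>auto simp: free_module_def\<close>)
      then show "(\<lambda>i. \<ominus> f i) \<in> carrier ?M"
        using f by (simp add: free_module_def)
    qed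
  qed (simp add: free_module_def)
  fix f assume f: "f \<in> carrier ?M"
  show "\<one> \<odot>\<^bsub>?M\<^esub> f = f"
    using val[OF f] by (simp add: ops)
  fix c d assume c: "c \<in> carrier R"
  show "c \<odot>\<^bsub>?M\<^esub> f \<in> carrier ?M"
    using c f fin'[of f c] by (simp add: free_module_def)
  show "(c \<oplus> d) \<odot>\<^bsub>?M\<^esub> f = c \<odot>\<^bsub>?M\<^esub> f \<oplus>\<^bsub>?M\<^esub> d \<odot>\<^bsub>?M\<^esub> f" if "d \<in> carrier R"
    using val[OF f] c that by (simp add: ops l_distr)
  show "(c \<otimes> d) \<odot>\<^bsub>?M\<^esub> f = c \<odot>\<^bsub>?M\<^esub> (d \<odot>\<^bsub>?M\<^esub> f)" if "d \<in> carrier R"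
    using val[OF f] c that by (simp add: ops m_assoc)
  show "c \<odot>\<^bsub>?M\<^esub> (f \<oplus>\<^bsub>?M\<^esub> g) = c \<odot>\<^bsub>?M\<^esub> f \<oplus>\<^bsub>?M\<^esub> c \<odot>\<^bsub>?M\<^esub> g" if "g \<in> carrier ?M" for g
    using val[OF f] val[OF that] c by (simp add: ops r_distr)
qed (rule is_cring)

lemma (in cring) free_basis_closed:
  assumes "i \<in> S"
  shows "free_basis R i \<in> carrier (free_module R S)"
  using assms by (auto simp: free_module_def free_basis_def)

lemma (in module) generated_submodule_submodule:
  assumes "S \<subseteq> carrier M"
  shows "submodule (generated_submodule R M S) R M"
proof (rule submoduleI)
  show "generated_submodule R M S \<subseteq> carrier M"
    using assms carrier_is_submodule by (auto simp: generated_submodule_def)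
  show "\<zero>\<^bsub>M\<^esub> \<in> generated_submodule R M S"
    using submodule.axioms(1)[THEN subgroup.one_closed] by (auto simp: generated_submodule_def)
  show "\<ominus>\<^bsub>M\<^esub> x \<in> generated_submodule R M S" if "x \<in> generated_submodule R M S" for x
    using that submoduleE(3) unfolding generated_submodule_def by blast
  show "x \<oplus>\<^bsub>M\<^esub> y \<in> generated_submodule R M S"
    if "x \<in> generated_submodule R M S" "y \<in> generated_submodule R M S" for x y
    using that submoduleE(5) unfolding generated_submodule_def by blast
  show "a \<odot>\<^bsub>M\<^esub> x \<in> generated_submodule R M S"
    if "a \<in> carrier R" "x \<in> generated_submodule R M S" for a x
    using that submoduleE(4) unfolding generated_submodule_def by blast
qed

lemma generated_submodule_incl: "S \<subseteq> generated_submodule R M S"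
  by (auto simp: generated_submodule_def)

context
  fixes R :: "('a, 'm) ring_scheme" and M :: "('a, 'b, 'n) module_scheme" and N
  assumes M: "module R M" and N: "submodule N R M"
begin

interpretation module R M
  by (rule M)

interpretation N: abelian_subgroup N M
  by (rule abelian_subgroupI3)
     (use N M.abelian_group_axioms in \<open>auto simp: submodule_def additive_subgroup_def\<close>)

lemma quotient_module_add:
  assumes "x \<in> carrier M" "y \<in> carrier M"
  shows "(N +>\<^bsub>M\<^esub> x) \<oplus>\<^bsub>quotient_module M N\<^esub> (N +>\<^bsub>M\<^esub> y) = N +>\<^bsub>M\<^esub> (x \<oplus>\<^bsub>M\<^esub> y)"
  using N.a_rcos_sum[OF assms] by (simp add: quotient_module_def)

lemma quotient_module_smult:
  assumes "a \<in> carrier R" "x \<in> carrier M"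
  shows "a \<odot>\<^bsub>quotient_module M N\<^esub> (N +>\<^bsub>M\<^esub> x) = N +>\<^bsub>M\<^esub> (a \<odot>\<^bsub>M\<^esub> x)"
proof -
  have "N +>\<^bsub>M\<^esub> (a \<odot>\<^bsub>M\<^esub> y) = N +>\<^bsub>M\<^esub> (a \<odot>\<^bsub>M\<^esub> x)" if y: "y \<in> N +>\<^bsub>M\<^esub> x" for y
  proof -
    obtain n where n: "n \<in> N" "y = n \<oplus>\<^bsub>M\<^esub> x"
      using y by (auto simp: a_r_coset_def')
    then have "a \<odot>\<^bsub>M\<^esub> y = a \<odot>\<^bsub>M\<^esub> n \<oplus>\<^bsub>M\<^esub> a \<odot>\<^bsub>M\<^esub> x" "a \<odot>\<^bsub>M\<^esub> n \<in> N"
      using assms submoduleE(1,4)[OF N] by (auto simp: smult_r_distr)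
    then have "a \<odot>\<^bsub>M\<^esub> y \<in> N +>\<^bsub>M\<^esub> (a \<odot>\<^bsub>M\<^esub> x)"
      by (auto simp: a_r_coset_def')
    then show ?thesis
      using N.a_repr_independence' assms by (metis smult_closed)
  qed
  moreover have "x \<in> N +>\<^bsub>M\<^esub> x"
    using assms N.a_rcos_self by simp
  ultimately have "(\<Union>y \<in> N +>\<^bsub>M\<^esub> x. N +>\<^bsub>M\<^esub> (a \<odot>\<^bsub>M\<^esub> y)) = N +>\<^bsub>M\<^esub> (a \<odot>\<^bsub>M\<^esub> x)"
    by (intro UN_constant_eq ballI)
  then show ?thesis
    by (simp add: quotient_module_def)
qed

lemma quotient_module_module: "module R (quotient_module M N)"
proof (rule moduleI)
  have carr: "\<exists>x \<in> carrier M. C = N +>\<^bsub>M\<^esub> x" if "C \<in> carrier (quotient_module M N)" for C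
    using that by (auto simp: quotient_module_def A_RCOSETS_def')
  have carr': "N +>\<^bsub>M\<^esub> x \<in> carrier (quotient_module M N)" if "x \<in> carrier M" for x
    using that by (auto simp: quotient_module_def A_RCOSETS_def')
  have zero: "\<zero>\<^bsub>quotient_module M N\<^esub> = N +>\<^bsub>M\<^esub> \<zero>\<^bsub>M\<^esub>"
    using M.a_coset_add_zero[OF N.a_subset] by (simp add: quotient_module_def)
  note rules = carr' zero quotient_module_add quotient_module_smult
  show "abelian_group (quotient_module M N)"
  proof (rule abelian_groupI)
    fix C assume "C \<in> carrier (quotient_module M N)"
    then obtain x where x: "x \<in> carrier M" "C = N +>\<^bsub>M\<^esub> x"
      using carr by meson
    show "\<zero>\<^bsub>quotient_module M N\<^esub> \<oplus>\<^bsub>quotient_module M N\<^esub> C = C"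
      using x by (simp add: rules)
    show "\<exists>D \<in> carrier (quotient_module M N).
        D \<oplus>\<^bsub>quotient_module M N\<^esub> C = \<zero>\<^bsub>quotient_module M N\<^esub>"
      using x by (intro bexI[of _ "N +>\<^bsub>M\<^esub> (\<ominus>\<^bsub>M\<^esub> x)"]) (simp_all add: rules M.l_neg)
    fix D assume "D \<in> carrier (quotient_module M N)"
    then obtain y where y: "y \<in> carrier M" "D = N +>\<^bsub>M\<^esub> y"
      using carr by meson
    show "C \<oplus>\<^bsub>quotient_module M N\<^esub> D \<in> carrier (quotient_module M N)"
      using x y by (simp add: rules)
    show "C \<oplus>\<^bsub>quotient_module M N\<^esub> D = D \<oplus>\<^bsub>quotient_module M N\<^esub> C"
      using x y by (simp add: rules M.a_comm)
    fix E assume "E \<in> carrier (quotient_module M N)"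
    then obtain z where z: "z \<in> carrier M" "E = N +>\<^bsub>M\<^esub> z"
      using carr by meson
    show "C \<oplus>\<^bsub>quotient_module M N\<^esub> D \<oplus>\<^bsub>quotient_module M N\<^esub> E =
        C \<oplus>\<^bsub>quotient_module M N\<^esub> (D \<oplus>\<^bsub>quotient_module M N\<^esub> E)"
      using x y z by (simp add: rules M.a_assoc)
  qed (simp add: rules)
  fix C assume "C \<in> carrier (quotient_module M N)"
  then obtain x where x: "x \<in> carrier M" "C = N +>\<^bsub>M\<^esub> x"
    using carr by meson
  show "\<one>\<^bsub>R\<^esub> \<odot>\<^bsub>quotient_module M N\<^esub> C = C"
    using x by (simp add: rules)
  fix a assume a: "a \<in> carrier R"
  show "a \<odot>\<^bsub>quotient_module M N\<^esub> C \<in> carrier (quotient_module M N)"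
    using a x by (simp add: rules)
  show "(a \<oplus>\<^bsub>R\<^esub> b) \<odot>\<^bsub>quotient_module M N\<^esub> C =
      a \<odot>\<^bsub>quotient_module M N\<^esub> C \<oplus>\<^bsub>quotient_module M N\<^esub> b \<odot>\<^bsub>quotient_module M N\<^esub> C"
    if "b \<in> carrier R" for b
    using that a x by (simp add: rules smult_l_distr)
  show "(a \<otimes>\<^bsub>R\<^esub> b) \<odot>\<^bsub>quotient_module M N\<^esub> C =
      a \<odot>\<^bsub>quotient_module M N\<^esub> (b \<odot>\<^bsub>quotient_module M N\<^esub> C)"
    if "b \<in> carrier R" for b
    using that a x by (simp add: rules smult_assoc1)
  fix D assume "D \<in> carrier (quotient_module M N)"
  then obtain y where y: "y \<in> carrier M" "D = N +>\<^bsub>M\<^esub> y"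
    using carr by meson
  show "a \<odot>\<^bsub>quotient_module M N\<^esub> (C \<oplus>\<^bsub>quotient_module M N\<^esub> D) =
      a \<odot>\<^bsub>quotient_module M N\<^esub> C \<oplus>\<^bsub>quotient_module M N\<^esub> a \<odot>\<^bsub>quotient_module M N\<^esub> D"
    using a x y by (simp add: rules smult_r_distr)
qed (rule R.is_cring)

end

context
  fixes B :: "('a, 'm) ring_scheme" (structure) and A
  assumes B: "cring B" and A: "A \<subseteq> carrier B"
begin

interpretation cring B
  by (rule B)

interpretation M: module B "free_module B (carrier B)"
  by (rule free_module_module)

lemma kaehler_submodule_submodule: "submodule (kaehler_submodule B A) B (free_module B (carrier B))"
proof -
  have "kaehler_relations B A \<subseteq> carrier (free_module B (carrier B))"
    using A by (auto simp: kaehler_relations_def Let_def subset_iff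
        intro!: free_basis_closed M.minus_closed M.add.m_closed M.smult_closed)
  then show ?thesis
    unfolding kaehler_submodule_def by (rule M.generated_submodule_submodule)
qed

lemma kaehler_differentials_module: "module B (kaehler_differentials B A)"
  unfolding kaehler_differentials_def
  by (rule quotient_module_module[OF M.module_axioms kaehler_submodule_submodule])

lemmas kaehler_simps =
  quotient_module_add[OF M.module_axioms kaehler_submodule_submodule]
  quotient_module_smult[OF M.module_axioms kaehler_submodule_submodule]

lemma kaehler_coset_eqI:
  assumes "x \<in> carrier (free_module B (carrier B))" "y \<in> carrier (free_module B (carrier B))"
    and "x \<ominus>\<^bsub>free_module B (carrier B)\<^esub> y \<in> kaehler_relations B A"
  shows "kaehler_submodule B A +>\<^bsub>free_module B (carrier B)\<^esub> x =
    kaehler_submodule B A +>\<^bsub>free_module B (carrier B)\<^esub> y"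
proof -
  interpret N: abelian_subgroup "kaehler_submodule B A" "free_module B (carrier B)"
    by (rule abelian_subgroupI3)
       (use kaehler_submodule_submodule M.abelian_group_axioms in \<open>auto simp: submodule_def additive_subgroup_def\<close>)
  have "x \<ominus>\<^bsub>free_module B (carrier B)\<^esub> y \<in> kaehler_submodule B A"
    using subsetD[OF generated_submodule_incl assms(3)] by (simp add: kaehler_submodule_def)
  then have "x \<in> kaehler_submodule B A +>\<^bsub>free_module B (carrier B)\<^esub> y"
    using N.a_rcos_module[of y x] assms(1,2) by (simp add: a_minus_def)
  then show ?thesis
    by (rule N.a_repr_independence'[OF _ assms(2), symmetric])
qed

lemma kaehler_d_closed:
  assumes "b \<in> carrier B"
  shows "kaehler_d B A b \<in> carrier (kaehler_differentials B A)"
  using free_basis_closed[OF assms]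
  by (auto simp: kaehler_d_def kaehler_differentials_def quotient_module_def A_RCOSETS_def')

lemma kaehler_d_add:
  assumes "b \<in> carrier B" "c \<in> carrier B"
  shows "kaehler_d B A (b \<oplus> c) =
    kaehler_d B A b \<oplus>\<^bsub>kaehler_differentials B A\<^esub> kaehler_d B A c"
proof -
  let ?M = "free_module B (carrier B)"
  have "free_basis B (b \<oplus> c) \<ominus>\<^bsub>?M\<^esub> (free_basis B b \<oplus>\<^bsub>?M\<^esub> free_basis B c) \<in> kaehler_relations B A"
    using assms unfolding kaehler_relations_def Let_def by blast
  then show ?thesis
    using assms unfolding kaehler_d_def kaehler_differentials_def
    by (simp add: kaehler_simps free_basis_closed kaehler_coset_eqI)
qed

lemma kaehler_d_mult:
  assumes "b \<in> carrier B" "c \<in> carrier B"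
  shows "kaehler_d B A (b \<otimes> c) =
    b \<odot>\<^bsub>kaehler_differentials B A\<^esub> kaehler_d B A c \<oplus>\<^bsub>kaehler_differentials B A\<^esub>
    c \<odot>\<^bsub>kaehler_differentials B A\<^esub> kaehler_d B A b"
proof -
  let ?M = "free_module B (carrier B)"
  have "free_basis B (b \<otimes> c) \<ominus>\<^bsub>?M\<^esub> (b \<odot>\<^bsub>?M\<^esub> free_basis B c \<oplus>\<^bsub>?M\<^esub> c \<odot>\<^bsub>?M\<^esub> free_basis B b)
      \<in> kaehler_relations B A"
    using assms unfolding kaehler_relations_def Let_def by blast
  then show ?thesis
    using assms unfolding kaehler_d_def kaehler_differentials_def
    by (simp add: kaehler_simps free_basis_closed kaehler_coset_eqI)
qed

lemma kaehler_d_scalar: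
  assumes "a \<in> A"
  shows "kaehler_d B A a = \<zero>\<^bsub>kaehler_differentials B A\<^esub>"
proof -
  have "free_basis B a \<in> kaehler_submodule B A"
    unfolding kaehler_submodule_def
    by (rule subsetD[OF generated_submodule_incl])
       (use assms in \<open>auto simp: kaehler_relations_def Let_def\<close>)
  moreover have "subgroup (kaehler_submodule B A) (add_monoid (free_module B (carrier B)))"
    using kaehler_submodule_submodule by (rule submodule.axioms(1))
  moreover have "free_basis B a \<in> carrier (free_module B (carrier B))"
    using assms A by (intro free_basis_closed) auto
  ultimately show ?thesis
    by (simp add: kaehler_d_def kaehler_differentials_def quotient_module_def M.a_coset_join2)
qed

end

end

theory Submission
  imports Defs
begin

text \<open>
  By the primitive element theorem the residue field extension is generated by a residue \<open>\<xi> \<noteq> 0\<close>;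
  lift it to \<open>x\<close>. Since \<open>1, \<xi>, \<dots>, \<xi>\<^sup>n\<^sup>-\<^sup>1\<close> are linearly independent over the residue field of \<open>K\<close>, the
  value of a linear combination of \<open>1, x, \<dots>, x\<^sup>n\<^sup>-\<^sup>1\<close> over \<open>K\<close> is the least value of its coefficients.
  As \<open>n = [L : K]\<close>, these powers form a basis of \<open>L\<close> over \<open>K\<close>, and integral elements have integral
  coordinates. Writing \<open>x\<^sup>n\<close> in this basis yields a monic integral polynomial \<open>f\<close> with
  \<open>f(x) = 0\<close> that reduces to the minimal polynomial of \<open>\<xi>\<close>. By separability \<open>f'(x)\<close> is a unit,
  and \<open>f'(x) dx = d(f(x)) = 0\<close> gives \<open>dx = 0\<close>.
\<close>

section \<open>The derivative of a polynomial at a point\<close>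

(* otherwise integer multiples [n] \<cdot> x are parsed ambiguously *)
no_notation ideal_prod (infixl "\<cdot>\<index>" 80)

context ring
begin

text \<open>The value p'(x) is read off the coefficient list directly, so leading zeros do no harm
  and the rules of differentiation follow by list induction. At the constant coefficient the
  multiple is 0, which makes the truncated exponent \<open>length p - 1\<close> harmless.\<close>

fun deriv_eval :: "'a list \<Rightarrow> 'a \<Rightarrow> 'a"
  where
    "deriv_eval [] x = \<zero>"
  | "deriv_eval (a # p) x = [length p] \<cdot> (a \<otimes> x [^] (length p - 1)) \<oplus> deriv_eval p x"

lemma deriv_eval_closed [simp]:
  "\<lbrakk> set p \<subseteq> carrier R; x \<in> carrier R \<rbrakk> \<Longrightarrow> deriv_eval p x \<in> carrier R"
  by (induction p) auto

lemma deriv_eval_replicate: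
  assumes "set p \<subseteq> carrier R" "x \<in> carrier R"
  shows "deriv_eval (replicate n \<zero> @ p) x = deriv_eval p x"
  using assms by (induction n) auto

lemma deriv_eval_normalize:
  assumes "set p \<subseteq> carrier R" "x \<in> carrier R"
  shows "deriv_eval (normalize p) x = deriv_eval p x"
  using deriv_eval_replicate[OF normalize_in_carrier] normalize_def'[of p] assms by metis

lemma deriv_eval_map2_add:
  assumes "length p = length q" "set p \<subseteq> carrier R" "set q \<subseteq> carrier R" "x \<in> carrier R"
  shows "deriv_eval (map2 (\<oplus>) p q) x = deriv_eval p x \<oplus> deriv_eval q x"
  using assms
proof (induction p q rule: list_induct2)
  case (Cons a p b q)
  let ?n = "length q" and ?y = "x [^] (length q - 1)"
  have "[?n] \<cdot> ((a \<oplus> b) \<otimes> ?y) = [?n] \<cdot> (a \<otimes> ?y) \<oplus> [?n] \<cdot> (b \<otimes> ?y)"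
    using Cons.prems by (simp add: l_distr add.nat_pow_distrib)
  then show ?case
    using Cons by (simp add: a_ac)
qed simp

lemma deriv_eval_poly_add:
  assumes "set p \<subseteq> carrier R" "set q \<subseteq> carrier R" "x \<in> carrier R"
  shows "deriv_eval (poly_add p q) x = deriv_eval p x \<oplus> deriv_eval q x"
proof -
  have *: "deriv_eval (poly_add p q) x = deriv_eval p x \<oplus> deriv_eval q x"
    if "length q \<le> length p" "set p \<subseteq> carrier R" "set q \<subseteq> carrier R" for p q
  proof -
    let ?q = "replicate (length p - length q) \<zero> @ q"
    have "set ?q \<subseteq> carrier R"
      using that by auto
    then have "set (map2 (\<oplus>) p ?q) \<subseteq> carrier R"
      using that(2) unfolding set_map
      by (intro image_subsetI) (auto intro!: a_closed simp del: set_append dest: set_zip_leftD set_zip_rightD)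
    then show ?thesis
      using that assms(3) deriv_eval_map2_add[of p ?q x]
      by (simp add: deriv_eval_normalize deriv_eval_replicate subset_iff)
  qed
  show ?thesis
  proof (cases "length q \<le> length p")
    case False
    then show ?thesis
      using *[of p q] assms poly_add_comm[of p q] by (simp add: a_comm)
  qed (use *[of q p] assms in simp)
qed

end

context cring
begin

text \<open>Appending \<open>n\<close> zeros multiplies by X^n, so this is the product rule for that
  special product. For \<open>n = 0\<close> the last summand vanishes because of the multiple
  0.\<close>

lemma deriv_eval_append_zeros:
  assumes "set p \<subseteq> carrier R" "x \<in> carrier R"
  shows "deriv_eval (p @ replicate n \<zero>) x =
    deriv_eval p x \<otimes> x [^] n \<oplus> eval p x \<otimes> ([n] \<cdot> (x [^] (n - 1)))"
proof -
  have zeros: "deriv_eval (replicate n \<zero>) x = \<zero>" for n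
    using deriv_eval_replicate[of "[]" x n] assms by simp
  show ?thesis
    using assms
  proof (induction p)
    case (Cons a p)
    define m where "m = length p"
    have *: "[(m + n)] \<cdot> (a \<otimes> x [^] (m + n - 1)) =
      [m] \<cdot> (a \<otimes> x [^] (m - 1)) \<otimes> x [^] n \<oplus> a \<otimes> x [^] m \<otimes> ([n] \<cdot> (x [^] (n - 1)))"
    proof -
      have "[m] \<cdot> (a \<otimes> x [^] (m - 1)) \<otimes> x [^] n = [m] \<cdot> (a \<otimes> x [^] (m + n - 1))"
        using Cons.prems by (cases m) (simp_all add: add_pow_ldistr m_assoc nat_pow_mult l_distr add_ac)
      moreover have "a \<otimes> x [^] m \<otimes> ([n] \<cdot> (x [^] (n - 1))) = [n] \<cdot> (a \<otimes> x [^] (m + n - 1))"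
        using Cons.prems by (cases n) (simp_all add: add_pow_rdistr m_assoc nat_pow_mult r_distr)
      ultimately show ?thesis
        using Cons.prems by (simp add: add.nat_pow_mult)
    qed
    have cl: "a \<in> carrier R" "deriv_eval p x \<in> carrier R" "eval p x \<in> carrier R"
      using Cons.prems by (simp_all add: eval_in_carrier)
    then show ?case
      using Cons * by (simp add: m_def[symmetric] l_distr a_ac)
  qed (simp add: zeros assms)
qed

lemma deriv_eval_scalar:
  assumes "set p \<subseteq> carrier R" "x \<in> carrier R" "a \<in> carrier R"
  shows "deriv_eval (map ((\<otimes>) a) p) x = a \<otimes> deriv_eval p x"
  using assms by (induction p) (simp_all add: r_distr add_pow_rdistr m_assoc)

lemma eval_scalar:
  assumes "set p \<subseteq> carrier R" "x \<in> carrier R" "a \<in> carrier R"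
  shows "eval (map ((\<otimes>) a) p) x = a \<otimes> eval p x"
  using assms by (induction p) (simp_all add: r_distr m_assoc eval_in_carrier)

text \<open>Induction along \<open>poly_mult\<close>, which adds the shifted multiple of
  \<open>q\<close> by the leading coefficient to the product of the tail with \<open>q\<close>; the
  shift is handled by \<open>deriv_eval_append_zeros\<close>.\<close>

lemma deriv_eval_poly_mult:
  assumes "set p \<subseteq> carrier R" "set q \<subseteq> carrier R" "x \<in> carrier R"
  shows "deriv_eval (poly_mult p q) x = deriv_eval p x \<otimes> eval q x \<oplus> eval p x \<otimes> deriv_eval q x"
  using assms
proof (induction p)
  case (Cons a p)
  let ?n = "length p"
  let ?q = "map ((\<otimes>) a) q"
  have q: "set ?q \<subseteq> carrier R" "set (?q @ replicate ?n \<zero>) \<subseteq> carrier R"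
    using Cons.prems by auto
  have cl: "a \<in> carrier R" "deriv_eval p x \<in> carrier R" "eval p x \<in> carrier R"
    "deriv_eval q x \<in> carrier R" "eval q x \<in> carrier R" "[?n] \<cdot> (x [^] (?n - 1)) \<in> carrier R"
    "x [^] ?n \<in> carrier R"
    using Cons.prems by (simp_all add: eval_in_carrier)
  have "deriv_eval (poly_mult (a # p) q) x =
      deriv_eval (?q @ replicate ?n \<zero>) x \<oplus> deriv_eval (poly_mult p q) x"
    using Cons.prems q deriv_eval_poly_add[OF q(2) poly_mult_in_carrier]
    by (simp del: poly_add.simps)
  also have "\<dots> = a \<otimes> deriv_eval q x \<otimes> x [^] ?n \<oplus> a \<otimes> eval q x \<otimes> ([?n] \<cdot> (x [^] (?n - 1))) \<oplus>
      (deriv_eval p x \<otimes> eval q x \<oplus> eval p x \<otimes> deriv_eval q x)"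
    using Cons q by (simp add: deriv_eval_append_zeros deriv_eval_scalar eval_scalar)
  also have "\<dots> = (a \<otimes> ([?n] \<cdot> (x [^] (?n - 1))) \<oplus> deriv_eval p x) \<otimes> eval q x \<oplus>
      (a \<otimes> x [^] ?n \<oplus> eval p x) \<otimes> deriv_eval q x"
    using cl by algebra
  also have "a \<otimes> ([?n] \<cdot> (x [^] (?n - 1))) = [?n] \<cdot> (a \<otimes> x [^] (?n - 1))"
    using Cons.prems by (simp add: add_pow_rdistr)
  finally show ?case
    by simp
qed (simp add: eval_in_carrier)

end

section \<open>Formal derivatives, ring homomorphisms and separability\<close>

lemma (in ring) eval_poly_deriv:
  assumes "set p \<subseteq> carrier R" "x \<in> carrier R"
  shows "eval (poly_deriv p) x = deriv_eval p x"
proof -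
  have cl: "set (map (\<lambda>i. [i] \<cdot> coeff p i) (rev [1..<length p])) \<subseteq> carrier R"
    using assms by auto
  have "eval (map (\<lambda>i. [i] \<cdot> coeff p i) (rev [1..<length p])) x = deriv_eval p x"
    using assms(1)
  proof (induction p)
    case (Cons a p)
    \<comment> \<open>All indices in this list lie below \<open>length p\<close>, so the head
      \<open>a\<close>, whose index is \<open>length p\<close>, is never read.\<close>
    have *: "map (\<lambda>i. [i] \<cdot> coeff (a # p) i) (rev [1..<length p]) =
        map (\<lambda>i. [i] \<cdot> coeff p i) (rev [1..<length p])"
      by (rule map_cong) auto
    show ?case
    proof (cases "length p = 0")
      case False
      then have "rev [1..<length (a # p)] = length p # rev [1..<length p]"
        by (simp add: Suc_le_eq)
      then have "eval (map (\<lambda>i. [i] \<cdot> coeff (a # p) i) (rev [1..<length (a # p)])) x =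
          ([length p] \<cdot> a) \<otimes> x [^] (length p - 1) \<oplus>
          eval (map (\<lambda>i. [i] \<cdot> coeff (a # p) i) (rev [1..<length p])) x"
        by simp
      then show ?thesis
        using Cons assms(2) by (simp only: *) (simp add: add_pow_ldistr)
    qed (use Cons.prems in simp)
  qed simp
  then show ?thesis
    unfolding poly_deriv_def using eval_normalize[OF cl assms(2)] by simp
qed

lemma (in ring) poly_deriv_closed:
  assumes "subring K R" "p \<in> carrier (K[X])"
  shows "poly_deriv p \<in> carrier (K[X])"
proof -
  have p: "set p \<subseteq> K"
    using assms(2) by (simp add: univ_poly_carrier[symmetric] polynomial_incl)
  have "coeff p i \<in> K" for i
    using rangeI[of "coeff p" i] p subringE(2)[OF assms(1)] unfolding coeff_img(3) by auto
  moreover have "[n] \<cdot> a \<in> K" if "a \<in> K" for a and n :: nat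
    by (induction n) (simp_all add: that subringE(2,7)[OF assms(1)])
  ultimately have "set (map (\<lambda>i. [i] \<cdot> coeff p i) (rev [1..<length p])) \<subseteq> K"
    by auto
  then show ?thesis
    unfolding poly_deriv_def univ_poly_carrier[symmetric] by (rule normalize_gives_polynomial)
qed

lemma (in ring_hom_ring) deriv_eval_hom:
  assumes "x \<in> carrier R" "set p \<subseteq> carrier R"
  shows "h (R.deriv_eval p x) = S.deriv_eval (map h p) (h x)"
proof -
  have pow: "h ([n] \<cdot>\<^bsub>R\<^esub> a) = [n] \<cdot>\<^bsub>S\<^esub> h a" if "a \<in> carrier R" for a and n :: nat
    using that R.add.nat_pow_closed[OF that] by (induction n) (simp_all add: add_pow_def)
  show ?thesis
    using assms by (induction p) (simp_all add: pow hom_nat_pow)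
qed

text \<open>If the derivative vanished at \<open>x\<close>, the minimal polynomial would divide it.
  Being a common divisor of itself and its derivative, it would be a unit by separability, against
  irreducibility.\<close>

lemma (in domain) separable_Irr_deriv_eval:
  assumes "subfield K R" "x \<in> carrier R" "(algebraic over K) x" "separable_poly K (Irr K x)"
  shows "deriv_eval (Irr K x) x \<noteq> \<zero>"
proof
  assume 0: "deriv_eval (Irr K x) x = \<zero>"
  note sub = subfieldE(1)[OF assms(1)]
  interpret UP: domain "K[X]"
    by (rule univ_poly_is_domain[OF sub])
  note Irr = IrrE[OF assms(1-3)]
  note deriv = poly_deriv_closed[OF sub Irr(1)]
  have "set (Irr K x) \<subseteq> carrier R"
    using Irr(1) subringE(1)[OF sub] by (auto simp: univ_poly_carrier[symmetric] polynomial_def)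
  then have "eval (poly_deriv (Irr K x)) x = \<zero>"
    using 0 assms(2) by (simp add: eval_poly_deriv)
  then have "Irr K x divides\<^bsub>K[X]\<^esub> poly_deriv (Irr K x)"
    using Irr_minimal[OF assms(1-3) deriv] pdivides_iff_shell[OF assms(1) Irr(1) deriv] by simp
  then have "Irr K x \<in> Units (K[X])"
    using assms(4) Irr(1) UP.divides_refl unfolding separable_poly_def by blast
  then show False
    using Irr(2) UP.ring_irreducibleE(4)[OF Irr(1)] by simp
qed


section \<open>The primitive element theorem\<close>

text \<open>Provides p(u + wX) with coefficients still in \<open>F\<close>; below it yields
  f(\<gamma> - cX) over K(\<gamma>). The recursion replaces a leading term a X^n by a (wX +
  u)^n.\<close>

lemma (in domain) eval_linear_subst:
  assumes F: "subring F R" and "u \<in> F" "w \<in> F" "set p \<subseteq> F"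
  shows "\<exists>q \<in> carrier (F[X]). \<forall>y \<in> carrier R. eval q y = eval p (u \<oplus> w \<otimes> y)"
  using assms(4)
proof (induction p)
  case Nil
  show ?case
    by (rule bexI[of _ "[]"]) (auto simp: univ_poly_def)
next
  case (Cons a p)
  interpret UP: domain "F[X]"
    by (rule univ_poly_is_domain[OF F])
  have F_sub: "F \<subseteq> carrier R"
    by (rule subringE(1)[OF F])
  obtain q where q: "q \<in> carrier (F[X])" "\<And>y. y \<in> carrier R \<Longrightarrow> eval q y = eval p (u \<oplus> w \<otimes> y)"
    using Cons by auto
  \<comment> \<open>Normalization is needed because \<open>w\<close> or \<open>a\<close> may be
    zero.\<close>
  let ?l = "normalize [w, u]" and ?a = "normalize [a]"
  have cl: "?l \<in> carrier (F[X])" "?a \<in> carrier (F[X])"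
    using assms(2,3) Cons.prems normalize_gives_polynomial[of "[w, u]" F]
      normalize_gives_polynomial[of "[a]" F]
    unfolding univ_poly_carrier by simp_all
  have "eval (?a \<otimes>\<^bsub>F[X]\<^esub> ?l [^]\<^bsub>F[X]\<^esub> length p \<oplus>\<^bsub>F[X]\<^esub> q) y = eval (a # p) (u \<oplus> w \<otimes> y)"
    if y: "y \<in> carrier R" for y
  proof -
    interpret ev: ring_hom_ring "F[X]" R "\<lambda>p. eval p y"
      by (rule eval_ring_hom[OF F y])
    have "eval ?l y = u \<oplus> w \<otimes> y" "eval ?a y = a"
      using assms(2,3) Cons.prems F_sub y eval_normalize[of "[w, u]" y] eval_normalize[of "[a]" y]
      by (auto simp: a_comm simp del: normalize.simps)
    then show ?thesis
      using cl q y by (simp add: ev.hom_nat_pow del: normalize.simps)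
  qed
  then show ?case
    using cl q(1) by (intro bexI[of _ "?a \<otimes>\<^bsub>F[X]\<^esub> ?l [^]\<^bsub>F[X]\<^esub> length p \<oplus>\<^bsub>F[X]\<^esub> q"]) simp_all
qed

text \<open>Write m = (X - b) q. The product rule gives m'(b) = q(b), so b is not a root of q. As m
  splits and has degree above 1, q has a root, and it differs from b.\<close>

lemma (in field) splitted_simple_root_imp_other_root:
  assumes "m \<in> carrier (poly_ring R)" "splitted m" "degree m > 1"
    and b: "b \<in> carrier R" "eval m b = \<zero>" "deriv_eval m b \<noteq> \<zero>"
  obtains b' where "b' \<in> carrier R" "eval m b' = \<zero>" "b' \<noteq> b"
proof -
  interpret UP: domain "poly_ring R"
    by (rule univ_poly_is_domain[OF carrier_is_subring])
  have m: "m \<noteq> []"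
    using assms(3) by auto
  have lin: "[\<one>, \<ominus> b] \<in> carrier (poly_ring R)"
    using b by (auto simp: univ_poly_carrier[symmetric] polynomial_def)
  have "[\<one>, \<ominus> b] pdivides m"
    using is_root_imp_pdivides[OF assms(1)] b m by (simp add: is_root_def)
  then obtain q where q: "q \<in> carrier (poly_ring R)" "m = [\<one>, \<ominus> b] \<otimes>\<^bsub>poly_ring R\<^esub> q"
    unfolding pdivides_def factor_def by auto
  have q0: "q \<noteq> []"
    using q m UP.r_null[OF lin] by (auto simp: univ_poly_zero)
  have sets: "set q \<subseteq> carrier R" "set [\<one>, \<ominus> b] \<subseteq> carrier R"
    using q(1) lin by (auto simp: univ_poly_carrier[symmetric] polynomial_def)
  have "deriv_eval m b = deriv_eval [\<one>, \<ominus> b] b \<otimes> eval q b \<oplus> eval [\<one>, \<ominus> b] b \<otimes> deriv_eval q b"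
    unfolding q(2) univ_poly_mult using deriv_eval_poly_mult[OF sets(2,1) b(1)] .
  also have "\<dots> = eval q b"
    using sets b by (simp add: r_neg eval_in_carrier)
  finally have qb: "eval q b \<noteq> \<zero>"
    using b(3) by simp
  have "roots m = add_mset b (roots q)"
    unfolding q(2) by (rule poly_mult_degree_one_monic_imp_same_roots[OF b(1) q(1) q0])
  then have "roots q \<noteq> {#}"
    using assms(2,3) by (auto simp: splitted_def)
  then obtain b' where "b' \<in># roots q"
    by auto
  then have b': "b' \<in> carrier R" "eval q b' = \<zero>"
    using roots_mem_iff_is_root[OF q(1)] by (auto simp: is_root_def)
  then have "eval m b' = \<zero>"
    using ring_hom_memE(2)[OF eval_is_hom[OF carrier_is_subring b'(1)] lin q(1)] q(2) b
    by (simp add: is_root_def)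
  then show ?thesis
    using that b' qb by blast
qed

lemma (in domain) finite_roots:
  assumes "p \<in> carrier (poly_ring R)" "p \<noteq> []"
  shows "finite {x \<in> carrier R. eval p x = \<zero>}"
proof -
  have "{x \<in> carrier R. eval p x = \<zero>} = set_mset (roots p)"
    using roots_mem_iff_is_root[OF assms(1)] assms(2) by (auto simp: is_root_def)
  then show ?thesis
    by simp
qed

text \<open>
  With \<open>\<gamma> = a + cb\<close>, the minimal polynomial of \<open>b\<close> over \<open>K(\<gamma>)\<close> divides both \<open>g\<close> and
  \<open>f (\<gamma> - cX)\<close>. Away from finitely many \<open>c\<close> these have no common root other than \<open>b\<close>, and
  \<open>b\<close> is a simple root of \<open>g\<close>; so the minimal polynomial is linear.
\<close>

lemma (in field) primitive_element_two_aux: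
  assumes K: "subfield K R" "infinite K"
    and F: "subfield F R" "K \<subseteq> F" "\<And>p. p \<in> carrier (F[X]) \<Longrightarrow> splitted p"
    and a: "a \<in> F" "f \<in> carrier (K[X])" "f \<noteq> []" "eval f a = \<zero>"
    and b: "b \<in> F" "g \<in> carrier (K[X])" "g \<noteq> []" "eval g b = \<zero>" "deriv_eval g b \<noteq> \<zero>"
  obtains c where "c \<in> F" "a \<in> simple_extension K c" "b \<in> simple_extension K c"
proof -
  have F_sub: "F \<subseteq> carrier R" and subF: "subring F R" and subK: "subring K R"
    using subfieldE(1,3) F(1) K(1) by auto
  have mono: "carrier (K1[X]) \<subseteq> carrier (K2[X])" if "K1 \<subseteq> K2" for K1 K2
    using that unfolding univ_poly_def polynomial_def by auto
  have carr: "a \<in> carrier R" "b \<in> carrier R"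
    using a(1) b(1) F_sub by auto
  have fg: "f \<in> carrier (poly_ring R)" "g \<in> carrier (poly_ring R)"
    using a(2) b(2) mono[of K "carrier R"] F(2) F_sub by auto
  define Za Zb where "Za = {x \<in> carrier R. eval f x = \<zero>}" and "Zb = {x \<in> carrier R. eval g x = \<zero>}"
  have fin: "finite Za" "finite Zb"
    unfolding Za_def Zb_def using finite_roots fg a(3) b(3) by auto
  \<comment> \<open>These are the solutions c of a + cb = a' + cb' for roots a' of f and b' of g
    with b' different from b. Pairs with b' = b merely enlarge this finite set.\<close>
  let ?bad = "(\<lambda>(a', b'). (a' \<ominus> a) \<otimes> inv (b \<ominus> b')) ` (Za \<times> Zb)"
  obtain c where c: "c \<in> K" "c \<notin> ?bad"
    using fin K(2) finite_subset[of K ?bad] by blast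
  then have cF: "c \<in> F" "c \<in> carrier R"
    using F(2) F_sub by auto
  define \<gamma> where "\<gamma> = a \<oplus> c \<otimes> b"
  have \<gamma>: "\<gamma> \<in> F" "\<gamma> \<in> carrier R"
    unfolding \<gamma>_def using a(1) b(1) cF F_sub subringE(6,7)[OF subF] by auto
  have alg: "(algebraic over K) a" "(algebraic over K) b"
    using algebraicI a(2-4) b(2-4) by auto
  have alg\<gamma>: "(algebraic over K) \<gamma>"
  proof -
    have S: "subring {x \<in> carrier R. (algebraic over K) x} R"
      by (rule subfieldE(1)[OF subfield_of_algebraics[OF K(1)]])
    have "c \<in> {x \<in> carrier R. (algebraic over K) x}"
      using algebraic_self[OF subK c(1)] cF by simp
    then have "\<gamma> \<in> {x \<in> carrier R. (algebraic over K) x}"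
      unfolding \<gamma>_def using alg carr by (intro subringE(6,7)[OF S]) auto
    then show ?thesis
      by simp
  qed
  \<comment> \<open>\<open>M\<close> is the field K(\<gamma>). Since it lies in \<open>F\<close>,
    the minimal polynomial of b over it splits by the assumption on \<open>F\<close>.\<close>
  define M where "M = simple_extension K \<gamma>"
  have M: "subfield M R" "K \<subseteq> M" "\<gamma> \<in> M" "M \<subseteq> F"
    unfolding M_def
    using simple_extension_is_subfield[OF K(1) \<gamma>(2)] alg\<gamma> simple_extension_incl[OF _ \<gamma>(2)]
      simple_extension_mem[OF subK \<gamma>(2)] simple_extension_subring_incl[OF subF F(2) \<gamma>(1)]
      subringE(1)[OF subK]
    by auto
  have subM: "subring M R"
    by (rule subfieldE(1)[OF M(1)])
  have algM: "(algebraic over M) b"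
    by (rule algebraic_mono[OF M(2) alg(2)])
  define m where "m = Irr M b"
  note Irr = IrrE[OF M(1) carr(2) algM, folded m_def]
  have mR: "m \<in> carrier (poly_ring R)"
    using Irr(1) mono[of M "carrier R"] M(4) F_sub by auto
  have "m pdivides g"
    unfolding m_def using Irr_minimal[OF M(1) carr(2) algM] b(2,4) mono[OF M(2)] by auto
  then obtain q where q: "q \<in> carrier (poly_ring R)" "g = m \<otimes>\<^bsub>poly_ring R\<^esub> q"
    unfolding pdivides_def factor_def by auto
  have sets: "set m \<subseteq> carrier R" "set q \<subseteq> carrier R"
    using q(1) mR by (auto simp: univ_poly_carrier[symmetric] polynomial_def)
  \<comment> \<open>As m(b) = 0, only one term of the product rule for g = mq survives; hence b is a
    simple root of m because it is one of g.\<close>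
  have "deriv_eval g b = deriv_eval m b \<otimes> eval q b"
    unfolding q(2) univ_poly_mult deriv_eval_poly_mult[OF sets carr(2)]
    using Irr(4) sets carr by (simp add: eval_in_carrier)
  then have dm: "deriv_eval m b \<noteq> \<zero>"
    using b(5) sets carr by (auto simp: eval_in_carrier)
  have "\<not> degree m > 1"
  proof
    assume "degree m > 1"
    then obtain b' where b': "b' \<in> carrier R" "eval m b' = \<zero>" "b' \<noteq> b"
      using splitted_simple_root_imp_other_root[OF mR F(3) _ carr(2) Irr(4) dm] Irr(1) mono[OF M(4)]
      by blast
    \<comment> \<open>The polynomial h is f(\<gamma> - cX). It vanishes at b because \<gamma> - cb =
      a, so m divides it and the second root b' of m is a root of h too.\<close>
    have "\<ominus> c \<in> M"
      using c(1) M(2) subringE(5)[OF subM] by auto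
    moreover have "set f \<subseteq> M"
      using a(2) M(2) by (auto simp: univ_poly_carrier[symmetric] polynomial_def)
    ultimately obtain h where h: "h \<in> carrier (M[X])"
        "\<And>y. y \<in> carrier R \<Longrightarrow> eval h y = eval f (\<gamma> \<oplus> \<ominus> c \<otimes> y)"
      using eval_linear_subst[OF subM M(3)] by blast
    have "\<gamma> \<oplus> \<ominus> c \<otimes> b = a"
      unfolding \<gamma>_def using carr cF by algebra
    then have "eval h b = \<zero>"
      using h(2) carr a(4) by simp
    then have "m pdivides h"
      unfolding m_def using Irr_minimal[OF M(1) carr(2) algM h(1)] by simp
    then have "eval f (\<gamma> \<oplus> \<ominus> c \<otimes> b') = \<zero>"
      using pdivides_imp_root_sharing[OF mR _ b'(1,2)] h(2) b'(1) by metis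
    moreover have "eval g b' = \<zero>"
      using pdivides_imp_root_sharing[OF mR \<open>m pdivides g\<close> b'(1,2)] .
    ultimately have Z: "\<gamma> \<oplus> \<ominus> c \<otimes> b' \<in> Za" "b' \<in> Zb"
      unfolding Za_def Zb_def using \<gamma> cF b'(1) by auto
    have nz: "b \<ominus> b' \<in> Units R"
      using b'(1,3) carr by (simp add: field_Units)
    \<comment> \<open>With a' = \<gamma> - cb' this is the equation a' - a = c(b - b'); solved for c
      it puts c among the excluded values.\<close>
    have "(\<gamma> \<oplus> \<ominus> c \<otimes> b') \<ominus> a = c \<otimes> (b \<ominus> b')"
      unfolding \<gamma>_def using carr cF b'(1) by algebra
    then have "((\<gamma> \<oplus> \<ominus> c \<otimes> b') \<ominus> a) \<otimes> inv (b \<ominus> b') = c"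
      using nz cF carr b'(1) by (simp add: m_assoc)
    then have "c \<in> ?bad"
      using Z by force
    then show False
      using c(2) by simp
  qed
  moreover have "degree m \<noteq> 0"
    using pirreducible_degree[OF M(1) Irr(1,2)] by simp
  ultimately have "degree m = 1"
    by simp
  then have "length m = 2"
    by simp
  then obtain s where s: "m = [\<one>, s]"
    using Irr(3) by (cases m; cases "tl m") auto
  then have sM: "s \<in> M"
    using Irr(1) by (auto simp: univ_poly_carrier[symmetric] polynomial_def)
  then have "b \<oplus> s = \<zero>" "s \<in> carrier R"
    using Irr(4) carr M(4) F_sub unfolding s by auto
  then have "b = \<ominus> s"
    using carr by (simp add: minus_equality)
  then have bM: "b \<in> M"
    using subringE(5)[OF subM sM] by simp
  have "a = \<gamma> \<oplus> \<ominus> (c \<otimes> b)"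
    unfolding \<gamma>_def using carr cF by algebra
  then have "a \<in> M"
    using bM M(2,3) c(1) subringE(5-7)[OF subM] by auto
  then show ?thesis
    using that \<gamma>(1) bM unfolding M_def by blast
qed

text \<open>Both sides are generated from zero by the Horner steps u x + k, which the homomorphism
  respects. This carries a primitive element found in an algebraic closure back to the original
  field.\<close>

lemma (in ring_hom_ring) simple_extension_hom:
  assumes "K \<subseteq> carrier R" "x \<in> carrier R"
  shows "S.simple_extension (h ` K) (h x) = h ` R.simple_extension K x"
proof
  have sub: "R.simple_extension K x \<subseteq> carrier R"
    by (rule R.simple_extension_in_carrier[OF assms])
  show "S.simple_extension (h ` K) (h x) \<subseteq> h ` R.simple_extension K x"
  proof
    fix y assume "y \<in> S.simple_extension (h ` K) (h x)"
    then show "y \<in> h ` R.simple_extension K x"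
    proof (induction rule: S.simple_extension.induct)
      case zero
      then show ?case
        using R.simple_extension.zero by (intro image_eqI[of _ h "\<zero>\<^bsub>R\<^esub>"]) simp_all
    next
      case (lin k1 k2)
      then obtain u k where u: "u \<in> R.simple_extension K x" "k1 = h u" "k \<in> K" "k2 = h k"
        by auto
      then have "k1 \<otimes>\<^bsub>S\<^esub> h x \<oplus>\<^bsub>S\<^esub> k2 = h (u \<otimes>\<^bsub>R\<^esub> x \<oplus>\<^bsub>R\<^esub> k)"
        using sub assms by (simp add: subset_iff)
      then show ?case
        using R.simple_extension.lin[OF u(1,3)] by simp
    qed
  qed
  show "h ` R.simple_extension K x \<subseteq> S.simple_extension (h ` K) (h x)"
  proof
    fix y assume "y \<in> h ` R.simple_extension K x"
    then obtain u where "u \<in> R.simple_extension K x" "y = h u"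
      by auto
    from this(1) have "h u \<in> S.simple_extension (h ` K) (h x)"
    proof (induction rule: R.simple_extension.induct)
      case (lin k1 k2)
      then have "h (k1 \<otimes>\<^bsub>R\<^esub> x \<oplus>\<^bsub>R\<^esub> k2) = h k1 \<otimes>\<^bsub>S\<^esub> h x \<oplus>\<^bsub>S\<^esub> h k2"
        using sub assms by (simp add: subset_iff)
      then show ?case
        using S.simple_extension.lin[of "h k1" "h ` K" "h x" "h k2"] lin by simp
    qed simp
    then show "y \<in> S.simple_extension (h ` K) (h x)"
      using \<open>y = h u\<close> by simp
  qed
qed

text \<open>Here \<open>F\<close> is the image of the field in an algebraic closure
  \<open>L\<close>: polynomials over \<open>F\<close> split in \<open>L\<close>, yet the primitive
  element obtained lies in \<open>F\<close> and so has a preimage. Injectivity of \<open>h\<close>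
  preserves the simple root and lets memberships be pulled back.\<close>

lemma (in field) primitive_element_two:
  assumes K: "subfield K R" "infinite K"
    and x: "x \<in> carrier R" "(algebraic over K) x"
    and y: "y \<in> carrier R" "(algebraic over K) y" "separable_poly K (Irr K y)"
  obtains z where "z \<in> carrier R" "x \<in> simple_extension K z" "y \<in> simple_extension K z"
proof -
  obtain L :: "(('a list \<times> nat) multiset \<Rightarrow> 'a) ring" and h
    where L: "algebraic_closure L (h ` carrier R)" "h \<in> ring_hom R L" and inj: "inj_on h (carrier R)"
    using exists_closure indexed_const_inj_on by metis
  interpret L: algebraic_closure L "h ` carrier R"
    by (rule L(1))
  interpret h: ring_hom_ring R L h
    by (rule ring_hom_ringI2[OF ring_axioms L.ring_axioms L(2)])
  note K_sub = subfieldE(3)[OF K(1)]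
  have IrrNil: "Irr K w \<noteq> []" if "w \<in> carrier R" "(algebraic over K) w" for w
    using IrrE(1-2)[OF K(1) that] unfolding ring_irreducible_def univ_poly_zero by auto
  have Irr: "map h (Irr K w) \<in> carrier ((h ` K)[X]\<^bsub>L\<^esub>)"
    "map h (Irr K w) \<noteq> []" "L.eval (map h (Irr K w)) (h w) = \<zero>\<^bsub>L\<^esub>"
    if w: "w \<in> carrier R" "(algebraic over K) w" for w
    using h.subfield_polynomial_hom[OF K(1) L.one_not_zero IrrE(1)[OF K(1) w]] IrrNil[OF w]
      h.eval_hom[OF subfieldE(1)[OF K(1)] w(1) IrrE(1)[OF K(1) w]] IrrE(4)[OF K(1) w]
    by simp_all
  have "set (Irr K y) \<subseteq> carrier R"
    using IrrE(1)[OF K(1) y(1,2)] K_sub by (auto simp: univ_poly_carrier[symmetric] polynomial_def)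
  then have d: "h (deriv_eval (Irr K y) y) =
      L.deriv_eval (map h (Irr K y)) (h y)" "deriv_eval (Irr K y) y \<in> carrier R"
    using h.deriv_eval_hom[OF y(1)] y(1) by simp_all
  have "L.deriv_eval (map h (Irr K y)) (h y) \<noteq> \<zero>\<^bsub>L\<^esub>"
  proof
    assume "L.deriv_eval (map h (Irr K y)) (h y) = \<zero>\<^bsub>L\<^esub>"
    then have "h (deriv_eval (Irr K y) y) = h \<zero>"
      using d(1) by simp
    then show False
      using inj_onD[OF inj _ d(2) zero_closed] separable_Irr_deriv_eval[OF K(1) y] by blast
  qed
  moreover have "infinite (h ` K)"
    using K(2) finite_imageD[OF _ inj_on_subset[OF inj K_sub]] by blast
  ultimately obtain c where c: "c \<in> h ` carrier R"
      "h x \<in> L.simple_extension (h ` K) c"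
      "h y \<in> L.simple_extension (h ` K) c"
    using L.primitive_element_two_aux[OF h.img_is_subfield(2)[OF K(1) L.one_not_zero] _
        L.subfield_axioms image_mono[OF K_sub] L.roots_over_subfield
        imageI[OF x(1)] Irr[OF x] imageI[OF y(1)] Irr[OF y(1,2)]]
    by metis
  from c(1) obtain z where z: "z \<in> carrier R" "c = h z"
    by auto
  have "w \<in> simple_extension K z"
    if "w \<in> carrier R" "h w \<in> L.simple_extension (h ` K) c" for w
    using that inj simple_extension_in_carrier[OF K_sub z(1)] 
    unfolding z(2) h.simple_extension_hom[OF K_sub z(1)] by (simp add: inj_on_image_mem_iff)
  then show ?thesis
    using that z(1) x(1) y(1) c(2,3) by blast
qed

text \<open>Over a finite \<open>K\<close> the whole field is finite, and a generator of its cyclic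
  multiplicative group is primitive. Over an infinite \<open>K\<close> the elements of a finite
  spanning list are adjoined one at a time.\<close>

lemma (in field) primitive_element:
  assumes K: "subfield K R" and fin: "finite_dimension K (carrier R)"
    and sep: "separable_extension K (carrier R)"
  obtains z where "z \<in> carrier R" "simple_extension K z = carrier R"
proof -
  note K_sub = subfieldE(3)[OF K] and subK = subfieldE(1)[OF K]
  obtain n where "dimension n K (carrier R)"
    using fin by blast
  then obtain Us where Us: "set Us \<subseteq> carrier R" "Span K Us = carrier R"
    using exists_base[OF K] by blast
  show ?thesis
  proof (cases "finite K")
    case True
    have "carrier R = {combine Ks Us | Ks. length Ks = length Us \<and> set Ks \<subseteq> K}"
      using Span_eq_combine_set_length_version[OF K Us(1)] Us(2) by (simp only:)
    also have "\<dots> = (\<lambda>Ks. combine Ks Us) ` {Ks. set Ks \<subseteq> K \<and> length Ks = length Us}"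
      by blast
    finally have "carrier R = (\<lambda>Ks. combine Ks Us) ` {Ks. set Ks \<subseteq> K \<and> length Ks = length Us}" .
    then have "finite (carrier R)"
      using finite_lists_length_eq[OF True, of "length Us"] by simp
    from finite_field_mult_group_has_gen[OF this, unfolded Multiplicative_Group.carrier_mult_of]
    obtain z where z: "z \<in> carrier R - {\<zero>}"
        "carrier R - {\<zero>} = {z [^] i | i :: nat. i \<in> UNIV}"
      by (rule bexE)
    from z(1) have zR: "z \<in> carrier R"
      by blast
    have S: "subring (simple_extension K z) R"
      by (rule simple_extension_is_subring[OF subK zR])
    have "z [^] i \<in> simple_extension K z" for i :: nat
      by (induction i) (simp_all add: subringE(3,6)[OF S] simple_extension_mem[OF subK zR])
    then have "carrier R - {\<zero>} \<subseteq> simple_extension K z"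
      unfolding z(2) by blast
    then have "carrier R \<subseteq> simple_extension K z"
      using subringE(2)[OF S] by auto
    then show ?thesis
      using that zR simple_extension_in_carrier[OF K_sub zR] by blast
  next
    case False
    \<comment> \<open>The element \<open>x\<close> found for the tail is merged with the next entry
      \<open>y\<close> by the two-element case, and K(z) then contains K(x).\<close>
    have "\<exists>z \<in> carrier R. set xs \<subseteq> simple_extension K z" if "set xs \<subseteq> carrier R" for xs
      using that
    proof (induction xs)
      case (Cons y xs)
      then obtain x where x: "x \<in> carrier R" "set xs \<subseteq> simple_extension K x"
        by auto
      have y: "y \<in> carrier R"
        using Cons.prems by simp
      have "(algebraic over K) x" "(algebraic over K) y" "separable_poly K (Irr K y)"
        using sep x(1) y unfolding separable_extension_def by blast+
      then obtain z where z: "z \<in> carrier R" "x \<in> simple_extension K z" "y \<in> simple_extension K z"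
        using primitive_element_two[OF K False x(1) _ y] by blast
      have "simple_extension K x \<subseteq> simple_extension K z"
        using simple_extension_subring_incl[OF simple_extension_is_subring[OF subK z(1)]
            simple_extension_incl[OF K_sub z(1)] z(2)] .
      then show ?case
        using x(2) z by auto
    qed auto
    then obtain z where z: "z \<in> carrier R" "set Us \<subseteq> simple_extension K z"
      using Us(1) by blast
    have S: "subring (simple_extension K z) R"
      by (rule simple_extension_is_subring[OF subK z(1)])
    \<comment> \<open>A subring containing \<open>K\<close> is closed under linear combinations over
      \<open>K\<close>, so it contains the span of \<open>Us\<close>, which is everything.\<close>
    have "subalgebra K (simple_extension K z) R"
      using simple_extension_incl[OF K_sub z(1)] subringE(6)[OF S] subring.axioms(1)[OF S]
      unfolding subalgebra_def subalgebra_axioms_def by blast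
    then have "carrier R \<subseteq> simple_extension K z"
      using subalgebra_Span_incl[OF K _ z(2)] Us(2) by simp
    then show ?thesis
      using that z(1) simple_extension_in_carrier[OF K_sub z(1)] by blast
  qed
qed


section \<open>Differentials of a simple extension\<close>

context
  fixes B :: "('a, 'm) ring_scheme" (structure) and A
  assumes B: "cring B" and A: "subring A B"
begin

interpretation cring B
  by (rule B)

interpretation M: module B "kaehler_differentials B A"
  by (rule kaehler_differentials_module[OF B subringE(1)[OF A]])

lemmas kaehler_d_closed_subring = kaehler_d_closed[OF B subringE(1)[OF A]]

lemma kaehler_d_pow:
  fixes n :: nat
  assumes "x \<in> carrier B"
  shows "kaehler_d B A (x [^] n) =
    [n] \<cdot> (x [^] (n - 1)) \<odot>\<^bsub>kaehler_differentials B A\<^esub> kaehler_d B A x"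
proof (induction n)
  case 0
  show ?case
    using kaehler_d_scalar[OF B subringE(1)[OF A] subringE(3)[OF A]]
      kaehler_d_closed_subring[OF assms]
    by (simp add: M.smult_l_null)
next
  case (Suc n)
  let ?\<Omega> = "kaehler_differentials B A"
  \<comment> \<open>For \<open>n = 0\<close> both sides are zero, although the exponent
    \<open>n - 1\<close> is truncated.\<close>
  have "x \<otimes> ([n] \<cdot> (x [^] (n - 1))) = [n] \<cdot> (x [^] n)"
    using assms by (cases n) (simp_all add: add_pow_rdistr r_distr m_comm)
  then have "kaehler_d B A (x [^] Suc n) =
      x [^] n \<odot>\<^bsub>?\<Omega>\<^esub> kaehler_d B A x \<oplus>\<^bsub>?\<Omega>\<^esub>
      [n] \<cdot> (x [^] n) \<odot>\<^bsub>?\<Omega>\<^esub> kaehler_d B A x"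
    using kaehler_d_mult[OF B subringE(1)[OF A], of "x [^] n" x] assms
      kaehler_d_closed_subring[OF assms] Suc
      M.smult_assoc1[of x "[n] \<cdot> (x [^] (n - 1))" "kaehler_d B A x"]
    by simp
  then show ?case
    using assms kaehler_d_closed_subring[OF assms]
      M.smult_l_distr[of "[n] \<cdot> (x [^] n)" "x [^] n" "kaehler_d B A x"]
    by (simp add: M.M.a_comm)
qed

text \<open>The chain rule d(p(x)) = p'(x) dx: the coefficients lie in \<open>A\<close>, so the
  Leibniz rule and the power rule leave only multiples of dx.\<close>

lemma kaehler_d_eval:
  assumes "x \<in> carrier B" "set p \<subseteq> A"
  shows "kaehler_d B A (eval p x) = deriv_eval p x \<odot>\<^bsub>kaehler_differentials B A\<^esub> kaehler_d B A x"
  using assms(2)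
proof (induction p)
  case Nil
  show ?case
    using kaehler_d_scalar[OF B subringE(1)[OF A] subringE(2)[OF A]]
      kaehler_d_closed_subring[OF assms(1)]
    by (simp add: M.smult_l_null)
next
  case (Cons a p)
  let ?\<Omega> = "kaehler_differentials B A"
  let ?n = "length p"
  have cl: "a \<in> carrier B" "set p \<subseteq> carrier B"
    using Cons.prems subringE(1)[OF A] by auto
  have "kaehler_d B A (a \<otimes> x [^] ?n) = a \<odot>\<^bsub>?\<Omega>\<^esub> kaehler_d B A (x [^] ?n)"
    using kaehler_d_mult[OF B subringE(1)[OF A] cl(1), of "x [^] ?n"]
      kaehler_d_scalar[OF B subringE(1)[OF A], of a] Cons.prems assms(1) cl(1)
      kaehler_d_closed_subring
    by simp
  also have "\<dots> = [?n] \<cdot> (a \<otimes> x [^] (?n - 1)) \<odot>\<^bsub>?\<Omega>\<^esub> kaehler_d B A x"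
    using M.smult_assoc1[of a "[?n] \<cdot> (x [^] (?n - 1))" "kaehler_d B A x"] assms(1) cl(1)
      kaehler_d_closed_subring
    by (simp add: kaehler_d_pow add_pow_rdistr)
  finally show ?case
    using kaehler_d_add[OF B subringE(1)[OF A], of "a \<otimes> x [^] ?n" "eval p x"] Cons assms(1) cl
      kaehler_d_closed_subring[OF assms(1)]
    by (simp add: eval_in_carrier M.smult_l_distr)
qed

text \<open>The classes db generate the module. If all of them vanish, the relation submodule
  contains every basis vector, hence the whole free module, and only one coset remains.\<close>

lemma kaehler_differentials_trivialI:
  assumes "\<And>b. b \<in> carrier B \<Longrightarrow> kaehler_d B A b = \<zero>\<^bsub>kaehler_differentials B A\<^esub>"
  shows "carrier (kaehler_differentials B A) = {\<zero>\<^bsub>kaehler_differentials B A\<^esub>}"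
proof -
  let ?F = "free_module B (carrier B)" and ?N = "kaehler_submodule B A"
  interpret F: module B ?F
    by (rule free_module_module)
  note N = kaehler_submodule_submodule[OF B subringE(1)[OF A]]
  note Nsub = F.submoduleE[OF N]
  interpret N: abelian_subgroup ?N ?F
    by (rule abelian_subgroupI3)
      (use N F.abelian_group_axioms in \<open>auto simp: submodule_def additive_subgroup_def\<close>)
  have basis: "free_basis B b \<in> ?N" if b: "b \<in> carrier B" for b
    using assms[OF b] N.a_rcos_self[OF free_basis_closed[OF b]]
    by (simp add: kaehler_d_def kaehler_differentials_def quotient_module_def)
  \<comment> \<open>Induction on a finite set \<open>S\<close> containing the support of
    \<open>f\<close>: one coordinate is split off as a multiple of a basis vector.\<close>
  have "f \<in> ?N" if "finite S" "f \<in> carrier ?F" "{i. f i \<noteq> \<zero>} \<subseteq> S" for f S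
    using that
  proof (induction S arbitrary: f)
    case empty
    then have "f = \<zero>\<^bsub>?F\<^esub>"
      by (auto simp: free_module_def)
    then show ?case
      using N.zero_closed by simp
  next
    case (insert i S)
    show ?case
    proof (cases "i \<in> carrier B")
      case False
      then have "f i = \<zero>"
        using insert.prems(1) by (simp add: free_module_def)
      then show ?thesis
        using insert by auto
    next
      case True
      let ?g = "f(i := \<zero>)"
      have val: "f j \<in> carrier B" for j
        using insert.prems(1) by (cases "j \<in> carrier B") (auto simp: free_module_def)
      have "finite {j. ?g j \<noteq> \<zero>}"
        by (rule finite_subset[OF _ insert.hyps(1)]) (use insert.prems(2) in auto)
      then have g: "?g \<in> carrier ?F"
        using insert.prems(1) True by (auto simp: free_module_def)
      have "{j. ?g j \<noteq> \<zero>} \<subseteq> S"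
        using insert.prems(2) by auto
      then have "?g \<in> ?N"
        by (rule insert.IH[OF g])
      moreover have "f i \<odot>\<^bsub>?F\<^esub> free_basis B i \<in> ?N"
        using Nsub(4)[OF val basis[OF True]] .
      moreover have "f = ?g \<oplus>\<^bsub>?F\<^esub> f i \<odot>\<^bsub>?F\<^esub> free_basis B i"
        using val by (auto simp: free_module_def free_basis_def)
      ultimately show ?thesis
        using Nsub(5) by metis
    qed
  qed
  then have "carrier ?F \<subseteq> ?N"
    by (auto simp: free_module_def)
  then have "?N +>\<^bsub>?F\<^esub> f = ?N" if "f \<in> carrier ?F" for f
    using F.M.a_coset_join2[OF that submodule.axioms(1)[OF N]] that by blast
  then show ?thesis
    using F.M.zero_closed
    by (auto simp: kaehler_differentials_def quotient_module_def A_RCOSETS_def'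
        intro!: bexI[of _ "\<zero>\<^bsub>?F\<^esub>"])
qed

text \<open>Applying d to f(x) = 0 and cancelling the unit f'(x) gives dx = 0. Every element of
  \<open>B\<close> is a polynomial in \<open>x\<close> over \<open>A\<close>, so its differential is
  a multiple of dx.\<close>

lemma kaehler_differentials_simple_extension:
  assumes x: "x \<in> carrier B" "simple_extension A x = carrier B"
    and f: "set f \<subseteq> A" "eval f x = \<zero>" "deriv_eval f x \<in> Units B"
  shows "carrier (kaehler_differentials B A) = {\<zero>\<^bsub>kaehler_differentials B A\<^esub>}"
proof (rule kaehler_differentials_trivialI)
  let ?\<Omega> = "kaehler_differentials B A"
  let ?u = "deriv_eval f x"
  have "?u \<odot>\<^bsub>?\<Omega>\<^esub> kaehler_d B A x = \<zero>\<^bsub>?\<Omega>\<^esub>"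
    using kaehler_d_eval[OF x(1) f(1)] f(2)
      kaehler_d_scalar[OF B subringE(1)[OF A] subringE(2)[OF A]] by simp
  then have "kaehler_d B A x = inv ?u \<odot>\<^bsub>?\<Omega>\<^esub> \<zero>\<^bsub>?\<Omega>\<^esub>"
    using M.smult_assoc1[of "inv ?u" ?u "kaehler_d B A x"] f(3) kaehler_d_closed_subring[OF x(1)]
    by (simp add: Units_closed)
  then have dx: "kaehler_d B A x = \<zero>\<^bsub>?\<Omega>\<^esub>"
    using f(3) by (simp add: M.smult_r_null)
  fix b assume "b \<in> carrier B"
  then obtain p where p: "p \<in> carrier (A[X])" "b = eval p x"
    using simple_extension_as_eval_img[OF subringE(1)[OF A] x(1)] x(2) by auto
  then have "set p \<subseteq> A"
    by (simp add: univ_poly_carrier[symmetric] polynomial_incl)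
  then show "kaehler_d B A b = \<zero>\<^bsub>?\<Omega>\<^esub>"
    using kaehler_d_eval[OF x(1)] p(2) dx subringE(1)[OF A] x(1)
    by (simp add: M.smult_r_null subset_trans)
qed

end


section \<open>Lifting a residue basis\<close>

text \<open>Lets linear combinations pass between the field \<open>L\<close> and its valuation ring,
  on which alone the residue map is a homomorphism.\<close>

lemma (in ring) combine_consistent:
  assumes "subring H R"
  shows "ring.combine (R\<lparr>carrier := H\<rparr>) = combine"
proof (intro ext)
  fix Ks Us
  show "ring.combine (R\<lparr>carrier := H\<rparr>) Ks Us = combine Ks Us"
    by (induction Ks Us rule: combine.induct)
      (simp_all add: ring.combine.simps[OF subring_is_ring[OF assms]])
qed

lemma (in ring) subring_restrict:
  assumes "subring H R" "subring H' R" "H' \<subseteq> H"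
  shows "subring H' (R\<lparr>carrier := H\<rparr>)"
  using ring.ring_incl_imp_subring[OF subring_is_ring[OF assms(1)], of H'] assms(3)
    subring_is_ring[OF assms(2)] by simp

lemma (in ring) eval_in_simple_extension:
  assumes "subring K R" "x \<in> carrier R" "set p \<subseteq> K"
  shows "eval p x \<in> simple_extension K x"
proof -
  have "normalize p \<in> carrier (K[X])"
    using normalize_gives_polynomial[OF assms(3)] by (simp add: univ_poly_carrier)
  moreover have "eval p x = eval (normalize p) x"
    using eval_normalize[OF _ assms(2)] assms(3) subringE(1)[OF assms(1)] by auto
  ultimately show ?thesis
    using simple_extension_as_eval_img[OF subringE(1)[OF assms(1)] assms(2)] by blast
qed

section \<open>The residue map and integral coordinates\<close>

context valued_field
begin

lemma residue_class_hom:
  "ring_hom_ring (L\<lparr>carrier := valuation_ring L v\<rparr>) (residue_field L v) (residue_class L v)"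
proof -
  interpret m: maximalideal "valuation_ideal L v" "L\<lparr>carrier := valuation_ring L v\<rparr>"
    by (rule valuation_ideal_maximal)
  show ?thesis
    using m.rcos_ring_hom_ring by (simp add: residue_class_def[abs_def] residue_field_def)
qed

lemma residue_class_surj: "carrier (residue_field L v) = residue_class L v ` valuation_ring L v"
  by (auto simp: residue_field_def FactRing_def A_RCOSETS_def' residue_class_def)

lemma residue_class_eq_zero_iff:
  assumes "x \<in> valuation_ring L v"
  shows "residue_class L v x = \<zero>\<^bsub>residue_field L v\<^esub> \<longleftrightarrow> v x \<noteq> 0"
proof -
  let ?O = "L\<lparr>carrier := valuation_ring L v\<rparr>" and ?m = "valuation_ideal L v"
  interpret O: cring ?O
    by (rule cring_valuation_ring)
  interpret m: maximalideal ?m ?O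
    by (rule valuation_ideal_maximal)
  have "residue_class L v x = \<zero>\<^bsub>residue_field L v\<^esub> \<longleftrightarrow> x \<in> ?m"
    using assms O.a_coset_join2[of x ?m] m.a_subgroup m.a_rcos_self[of x]
    by (auto simp: residue_class_def residue_field_def FactRing_def)
  also have "\<dots> \<longleftrightarrow> v x \<noteq> 0"
    using assms by (auto simp: valuation_ring_def valuation_ideal_def order_less_le)
  finally show ?thesis .
qed

lemma valuation_ring_restrict:
  assumes "K \<subseteq> carrier L"
  shows "valuation_ring (L\<lparr>carrier := K\<rparr>) v = K \<inter> valuation_ring L v"
  using assms by (auto simp: valuation_ring_def)

lemma subring_valuation_ring_restrict:
  assumes "subfield K L"
  shows "subring (valuation_ring (L\<lparr>carrier := K\<rparr>) v) L"
  using subring_inter[OF subfieldE(1)[OF assms] subring_valuation_ring]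
  unfolding valuation_ring_restrict[OF subfieldE(3)[OF assms]] .

text \<open>A nonzero residue lifts to an element of \<open>K\<close> of value 0. Its inverse again
  lies in \<open>K\<close> and has value 0, so the residue of the inverse is available.\<close>

lemma subfield_residue_subfield:
  assumes K: "subfield K L"
  shows "subfield (residue_subfield L v K) (residue_field L v)"
proof -
  let ?O = "L\<lparr>carrier := valuation_ring L v\<rparr>" and ?OK = "valuation_ring (L\<lparr>carrier := K\<rparr>) v"
  let ?\<rho> = "residue_class L v"
  interpret E: field "residue_field L v"
    by (rule field_residue_field)
  interpret h: ring_hom_ring ?O "residue_field L v" ?\<rho>
    by (rule residue_class_hom)
  have OK: "?OK = K \<inter> valuation_ring L v"
    by (rule valuation_ring_restrict[OF subfieldE(3)[OF K]])
  have "subring ?OK ?O"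
    using subring_restrict[OF subring_valuation_ring subring_valuation_ring_restrict[OF K]] OK by simp
  then have sub: "subring (residue_subfield L v K) (residue_field L v)"
    unfolding residue_subfield_def by (rule h.img_is_subring)
  show ?thesis
  proof (rule E.subfieldI'[OF sub])
    fix k assume "k \<in> residue_subfield L v K - {\<zero>\<^bsub>residue_field L v\<^esub>}"
    then obtain c where c: "c \<in> K" "c \<in> valuation_ring L v" "k = ?\<rho> c" "?\<rho> c \<noteq> \<zero>\<^bsub>residue_field L v\<^esub>"
      by (auto simp: residue_subfield_def OK)
    then have vc: "c \<in> carrier L" "v c = 0"
      using residue_class_eq_zero_iff by (auto simp: valuation_ring_def)
    note inv = val_inv[OF vc]
    have "c \<noteq> \<zero>"
      using vc(2) val_zero by (auto simp: zero_extended_def)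
    then have "inv c \<in> K"
      using subfield_m_inv(1)[OF K] c(1) by simp
    moreover have cO: "inv c \<in> valuation_ring L v"
      using inv by (simp add: valuation_ring_def)
    moreover have "?\<rho> (inv c) \<otimes>\<^bsub>residue_field L v\<^esub> k = \<one>\<^bsub>residue_field L v\<^esub>"
      using h.hom_mult[of "inv c" c] h.hom_one cO c(2,3) inv(3) by simp
    then have "inv\<^bsub>residue_field L v\<^esub> k = ?\<rho> (inv c)"
      using E.comm_inv_char[of k "?\<rho> (inv c)"] E.m_comm h.hom_closed[of "inv c"] h.hom_closed[of c]
        cO c(2,3) by simp
    ultimately show "inv\<^bsub>residue_field L v\<^esub> k \<in> residue_subfield L v K"
      by (auto simp: residue_subfield_def OK)
  qed
qed

text \<open>
  After division by a coefficient of least value, the combination has integral coefficients that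
  are not all zero in the residue field.
\<close>

lemma val_combine_le:
  assumes K: "subfield K L"
    and Us: "set Us \<subseteq> valuation_ring L v"
      "ring.independent (residue_field L v) (residue_subfield L v K) (map (residue_class L v) Us)"
    and Cs: "set Cs \<subseteq> K" "length Cs = length Us" "c \<in> set Cs"
  shows "v (combine Cs Us) \<le> v c"
proof -
  let ?O = "L\<lparr>carrier := valuation_ring L v\<rparr>" and ?\<rho> = "residue_class L v"
  interpret E: field "residue_field L v"
    by (rule field_residue_field)
  interpret h: ring_hom_ring ?O "residue_field L v" ?\<rho>
    by (rule residue_class_hom)
  have K_sub: "K \<subseteq> carrier L" and O_sub: "valuation_ring L v \<subseteq> carrier L"
    using subfieldE(3)[OF K] by (auto simp: valuation_ring_def)
  have "Min (v ` set Cs) \<in> v ` set Cs"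
    using Cs(3) by (intro Min_in) auto
  then obtain e where e: "e \<in> set Cs" "v e = Min (v ` set Cs)"
    by auto
  then have le: "v e \<le> v b" if "b \<in> set Cs" for b
    using that by simp
  show ?thesis
  proof (cases "e = \<zero>")
    case True
    \<comment> \<open>If the least value is infinite, so is the value of \<open>c\<close>, and the
      bound is trivial.\<close>
    then have "v c = \<infinity>"
      using le[OF Cs(3)] val_zero by (cases "v c") auto
    then show ?thesis
      by (cases "v (combine Cs Us)") auto
  next
    case False
    have eK: "e \<in> K" "e \<in> carrier L"
      using e(1) Cs(1) K_sub by auto
    have inv: "inv e \<in> K" "inv e \<in> carrier L" "e \<otimes> inv e = \<one>" "inv e \<otimes> e = \<one>"
      using subfield_m_inv[OF K, of e] eK False K_sub by auto
    have vinv: "v (inv e) + v e = 0"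
      using val_mult[OF inv(2) eK(2)] inv(4) val_one by simp
    define Ds where "Ds = map ((\<otimes>) (inv e)) Cs"
    have CsL: "set Cs \<subseteq> carrier L" and UsL: "set Us \<subseteq> carrier L"
      using Cs(1) K_sub Us(1) O_sub by auto
    have "inv e \<otimes> b \<in> valuation_ring (L\<lparr>carrier := K\<rparr>) v" if b: "b \<in> set Cs" for b
    proof -
      have "0 \<le> v (inv e) + v b"
        using add_left_mono[OF le[OF b], of "v (inv e)"] vinv by simp
      then show ?thesis
        using b Cs(1) CsL inv(1,2) subringE(6)[OF subfieldE(1)[OF K]]
        by (auto simp: valuation_ring_def val_mult subset_iff)
    qed
    then have Ds: "set Ds \<subseteq> valuation_ring (L\<lparr>carrier := K\<rparr>) v"
      by (auto simp: Ds_def)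
    then have DsO: "set Ds \<subseteq> valuation_ring L v"
      using valuation_ring_restrict[OF K_sub] by auto
    \<comment> \<open>Division turns the entry \<open>e\<close> into 1, so some coefficient has a
      nonzero residue, and independence of the residues of \<open>Us\<close> applies.\<close>
    have "\<one> \<in> set Ds"
      using e(1) inv(4) by (auto simp: Ds_def image_iff intro!: bexI[of _ e])
    then have one: "\<one>\<^bsub>residue_field L v\<^esub> \<in> set (map ?\<rho> Ds)"
      using h.hom_one by (auto simp: image_iff)
    let ?y = "combine Ds Us"
    have y: "?y \<in> valuation_ring L v"
      using ring.combine_in_carrier[OF h.R.ring_axioms, of Ds Us] DsO Us(1)
      unfolding combine_consistent[OF subring_valuation_ring] by simp
    have "?\<rho> ?y \<noteq> \<zero>\<^bsub>residue_field L v\<^esub>"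
    proof
      assume "?\<rho> ?y = \<zero>\<^bsub>residue_field L v\<^esub>"
      then have "E.combine (map ?\<rho> Ds) (map ?\<rho> Us) = \<zero>\<^bsub>residue_field L v\<^esub>"
        using h.combine_hom[of Ds Us] DsO Us(1)
        unfolding combine_consistent[OF subring_valuation_ring] by simp
      moreover have "set (map ?\<rho> Ds) \<subseteq> residue_subfield L v K"
        using Ds by (auto simp: residue_subfield_def)
      ultimately have "set (take (length (map ?\<rho> Us)) (map ?\<rho> Ds)) \<subseteq> {\<zero>\<^bsub>residue_field L v\<^esub>}"
        using E.independent_imp_trivial_combine[OF subfield_residue_subfield[OF K] Us(2)] by blast
      then have "set (map ?\<rho> Ds) \<subseteq> {\<zero>\<^bsub>residue_field L v\<^esub>}"
        using Cs(2) by (simp add: Ds_def)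
      then show False
        using one by auto
    qed
    then have vy: "v ?y = 0"
      using residue_class_eq_zero_iff[OF y] by simp
    have yL: "?y \<in> carrier L"
      using y O_sub by auto
    have "?y = inv e \<otimes> combine Cs Us"
      unfolding Ds_def using combine_r_distr[OF CsL UsL inv(2)] by simp
    then have "combine Cs Us = e \<otimes> ?y"
      using inv eK(2) CsL UsL by (simp add: m_assoc[symmetric])
    then have "v (combine Cs Us) = v e"
      using val_mult[OF eK(2) yL] vy by simp
    then show ?thesis
      using le[OF Cs(3)] by simp
  qed
qed

text \<open>By \<open>val_combine_le\<close>, a vanishing combination has coefficients of infinite
  value, so \<open>Us\<close> is independent and, having the right length, a basis. The same bound
  makes the coordinates of an integral element integral.\<close>

lemma residue_basis_imp_integral_basis:
  assumes K: "subfield K L" and dim: "dimension (length Us) K (carrier L)"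
    and Us: "set Us \<subseteq> valuation_ring L v"
      "ring.independent (residue_field L v) (residue_subfield L v K) (map (residue_class L v) Us)"
    and y: "y \<in> valuation_ring L v"
  obtains Cs where "set Cs \<subseteq> valuation_ring (L\<lparr>carrier := K\<rparr>) v" "length Cs = length Us"
    "y = combine Cs Us"
proof -
  have UsL: "set Us \<subseteq> carrier L" and yL: "y \<in> carrier L"
    using Us(1) y by (auto simp: valuation_ring_def)
  have "independent K Us"
  proof (rule ccontr)
    assume "dependent K Us"
    then obtain Cs where Cs: "length Cs = length Us" "combine Cs Us = \<zero>" "set Cs \<subseteq> K" "set Cs \<noteq> {\<zero>}"
      using dependent_imp_non_trivial_combine[OF K UsL] by metis
    have "c = \<zero>" if c: "c \<in> set Cs" for c
    proof -
      have "v c = \<infinity>"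
        using val_combine_le[OF K Us Cs(3,1) c] Cs(2) val_zero by (cases "v c") auto
      then show ?thesis
        using val_eq_Pinf_iff[of c] c Cs(3) subfieldE(3)[OF K] by auto
    qed
    \<comment> \<open>All entries are zero while \<open>set Cs\<close> is not
      \<open>{\<zero>}\<close>, so the list is empty. Then \<open>Us\<close> is empty too, and the
      empty list is independent.\<close>
    then have "Cs = []"
      using Cs(4) by (cases Cs) auto
    then show False
      using Cs(1) \<open>dependent K Us\<close> by auto
  qed
  then have "Span K Us = carrier L"
    using independent_length_eq_dimension[OF K dim _ UsL] by simp
  then obtain Cs where Cs: "set Cs \<subseteq> K" "length Cs = length Us" "y = combine Cs Us"
    using Span_eq_combine_set_length_version[OF K UsL] yL by blast
  have "c \<in> valuation_ring (L\<lparr>carrier := K\<rparr>) v" if c: "c \<in> set Cs" for c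
  proof -
    have "0 \<le> v c"
      using order_trans[OF _ val_combine_le[OF K Us Cs(1,2) c]] Cs(3) y by (simp add: valuation_ring_def)
    then show ?thesis
      using c Cs(1) by (auto simp: valuation_ring_def)
  qed
  then show ?thesis
    using that Cs(2,3) by blast
qed

end

section \<open>Generation of the valuation ring and vanishing of the differentials\<close>

text \<open>The number \<open>n\<close> is both the degree of L over K and the degree of the minimal
  polynomial of the residue of \<open>x\<close>. This is why \<open>n\<close> powers of
  \<open>x\<close> suffice and why a monic relation of degree \<open>n\<close> must reduce to that
  minimal polynomial.\<close>

lemma (in valued_field) unramified_simple_extension:
  assumes K: "subfield K L" and dim: "dimension n K (carrier L)"
    and x: "x \<in> carrier L" "v x = 0"
    and gen: "ring.simple_extension (residue_field L v) (residue_subfield L v K) (residue_class L v x) =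
      carrier (residue_field L v)"
    and sep: "ring.separable_extension (residue_field L v)
      (residue_subfield L v K) (carrier (residue_field L v))"
    and rdim: "ring.dimension (residue_field L v) n
      (residue_subfield L v K) (carrier (residue_field L v))"
  shows "valuation_ring L v = simple_extension (valuation_ring (L\<lparr>carrier := K\<rparr>) v) x"
    and "carrier (kaehler_differentials (L\<lparr>carrier := valuation_ring L v\<rparr>)
        (valuation_ring (L\<lparr>carrier := K\<rparr>) v)) =
      {\<zero>\<^bsub>kaehler_differentials (L\<lparr>carrier := valuation_ring L v\<rparr>)
        (valuation_ring (L\<lparr>carrier := K\<rparr>) v)\<^esub>}"
proof -
  let ?O = "L\<lparr>carrier := valuation_ring L v\<rparr>" and ?\<rho> = "residue_class L v"
  let ?E = "residue_field L v" and ?k = "residue_subfield L v K"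
  define OK where "OK = valuation_ring (L\<lparr>carrier := K\<rparr>) v"
  interpret E: field ?E
    by (rule field_residue_field)
  interpret h: ring_hom_ring ?O ?E ?\<rho>
    by (rule residue_class_hom)
  note O = subring_valuation_ring
  have k: "subfield ?k ?E"
    by (rule subfield_residue_subfield[OF K])
  have OK: "subring OK L" "OK \<subseteq> valuation_ring L v"
    unfolding OK_def using subring_valuation_ring_restrict[OF K]
      valuation_ring_restrict[OF subfieldE(3)[OF K]] by auto
  have OKO: "subring OK ?O"
    by (rule subring_restrict[OF O OK])
  have xO: "x \<in> valuation_ring L v"
    using x by (simp add: valuation_ring_def)
  define \<xi> where "\<xi> = ?\<rho> x"
  have \<xi>: "\<xi> \<in> carrier ?E"
    unfolding \<xi>_def using h.hom_closed[of x] xO by simp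
  have alg: "(E.algebraic over ?k) \<xi>" and sepx: "E.separable_poly ?k (E.Irr ?k \<xi>)"
    using sep \<xi> unfolding E.separable_extension_def by auto
  note Irr = E.IrrE[OF k \<xi> alg]
  have deg: "degree (E.Irr ?k \<xi>) = n"
    using E.dimension_is_inj[OF k E.dimension_simple_extension[OF k \<xi> alg]] rdim gen
    unfolding \<xi>_def by simp
  have xpow: "x [^] i \<in> valuation_ring L v" for i :: nat
    using h.R.nat_pow_closed[of x i] xO nat_pow_consistent[of x i] by simp
  define Us where "Us = exp_base x n"
  have Us: "set Us \<subseteq> valuation_ring L v" "length Us = n"
    using xpow by (auto simp: Us_def exp_base_def)
  have "?\<rho> (x [^] i) = \<xi> [^]\<^bsub>?E\<^esub> i" for i :: nat
    using h.hom_nat_pow[of x i] xO nat_pow_consistent[of x i] by (simp add: \<xi>_def)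
  then have mapUs: "map ?\<rho> Us = E.exp_base \<xi> n" and xn: "?\<rho> (x [^] n) = \<xi> [^]\<^bsub>?E\<^esub> n"
    by (simp_all add: Us_def exp_base_def E.exp_base_def)
  have ind: "E.independent ?k (map ?\<rho> Us)"
    unfolding mapUs using E.exp_base_independent[OF k \<xi> alg] deg by simp
  have comb: "\<exists>Cs. set Cs \<subseteq> OK \<and> length Cs = n \<and> y = combine Cs Us" if "y \<in> valuation_ring L v" for y
    using residue_basis_imp_integral_basis[OF K _ Us(1) ind that] dim Us(2) unfolding OK_def by metis
  \<comment> \<open>\<open>exp_base\<close> lists the powers from the highest down to 1, the order
    of coefficients in a polynomial.\<close>
  have evalx: "combine Cs Us = eval Cs x" if "length Cs = n" for Cs
    using combine_eq_eval[of Cs x] that by (simp add: Us_def)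
  show gen_O: "valuation_ring L v = simple_extension OK x"
  proof
    show "valuation_ring L v \<subseteq> simple_extension OK x"
      using comb evalx eval_in_simple_extension[OF OK(1) x(1)] by (metis subsetI)
    show "simple_extension OK x \<subseteq> valuation_ring L v"
      by (rule simple_extension_subring_incl[OF O OK(2) xO])
  qed
  have negO: "\<ominus> (x [^] n) \<in> valuation_ring L v"
    by (rule subringE(5)[OF O xpow])
  \<comment> \<open>Taking the coordinates of -x^n makes them the lower coefficients of a monic
    polynomial vanishing at \<open>x\<close>.\<close>
  then obtain Cs where Cs: "set Cs \<subseteq> OK" "length Cs = n" "\<ominus> (x [^] n) = combine Cs Us"
    using comb by blast
  let ?f = "\<one> # Cs"
  have f: "set ?f \<subseteq> OK"
    using Cs(1) subringE(3)[OF OK(1)] by simp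
  have f0: "eval ?f x = \<zero>"
    using evalx[OF Cs(2), folded Cs(3), symmetric] Cs(2) x(1) by (simp add: r_neg)
  \<comment> \<open>The residues of \<open>Cs\<close> and the lower coefficients of the minimal
    polynomial are both coordinates of -\<xi>^n with respect to the independent powers of \<xi>, so
    they agree.\<close>
  have map_f: "map ?\<rho> ?f = E.Irr ?k \<xi>"
  proof -
    obtain Ds where Ds: "E.Irr ?k \<xi> = \<one>\<^bsub>?E\<^esub> # Ds" "length Ds = n"
      using Irr(2,3) deg E.pirreducible_degree[OF k Irr(1,2)] by (cases "E.Irr ?k \<xi>") auto
    have Dsk: "set Ds \<subseteq> ?k"
      using Irr(1) unfolding Ds(1) by (simp add: univ_poly_carrier[symmetric] polynomial_def)
    have Csk: "set (map ?\<rho> Cs) \<subseteq> ?k"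
      using Cs(1) by (auto simp: residue_subfield_def OK_def)
    have DsE: "E.combine Ds (map ?\<rho> Us) \<in> carrier ?E"
      using Dsk E.subring_props(1)[OF k] E.independent_in_carrier[OF ind] by (intro E.combine_in_carrier) auto
    have xnE: "?\<rho> (x [^] n) \<in> carrier ?E"
      using h.hom_closed[of "x [^] n"] xpow by simp
    have "?\<rho> (\<ominus> (x [^] n)) \<oplus>\<^bsub>?E\<^esub> ?\<rho> (x [^] n) = \<zero>\<^bsub>?E\<^esub>"
      using h.hom_add[of "\<ominus> (x [^] n)" "x [^] n"] h.hom_zero negO xpow x(1) by (simp add: l_neg)
    then have "?\<rho> (\<ominus> (x [^] n)) = \<ominus>\<^bsub>?E\<^esub> ?\<rho> (x [^] n)"
      using E.minus_equality[OF _ xnE] h.hom_closed[of "\<ominus> (x [^] n)"] negO by simp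
    moreover have "E.combine Ds (map ?\<rho> Us) \<oplus>\<^bsub>?E\<^esub> ?\<rho> (x [^] n) = \<zero>\<^bsub>?E\<^esub>"
      using Irr(4) E.combine_eq_eval[of Ds \<xi>] Ds(2) \<xi> DsE
      unfolding Ds(1) mapUs xn by (simp add: E.a_comm)
    then have "E.combine Ds (map ?\<rho> Us) = \<ominus>\<^bsub>?E\<^esub> ?\<rho> (x [^] n)"
      using E.minus_equality[OF _ xnE DsE] by simp
    moreover have "E.combine (map ?\<rho> Cs) (map ?\<rho> Us) = ?\<rho> (\<ominus> (x [^] n))"
      using h.combine_hom[of Cs Us] Cs(1,3) Us(1) OK(2)
      unfolding combine_consistent[OF O] by simp
    ultimately have "E.combine (map ?\<rho> Cs) (map ?\<rho> Us) = E.combine Ds (map ?\<rho> Us)"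
      by simp
    moreover have "E.combine Ds (map ?\<rho> Us) \<in> E.Span ?k (map ?\<rho> Us)"
      using E.Span_eq_combine_set[OF k E.independent_in_carrier[OF ind]] Dsk by blast
    ultimately have "map ?\<rho> Cs = Ds"
      using E.unique_decomposition[OF k ind] Csk Dsk Cs(2) Ds(2) Us(2) by (metis length_map)
    then show ?thesis
      unfolding Ds(1) using h.hom_one by simp
  qed
  \<comment> \<open>The derivative is formed inside the valuation ring so that the residue map
    applies. Its residue is the derivative of the minimal polynomial at \<xi>, nonzero by
    separability.\<close>
  let ?d = "h.R.deriv_eval ?f x"
  have fO: "set ?f \<subseteq> carrier ?O"
    using f OK(2) by auto
  have dO: "?d \<in> valuation_ring L v"
    using h.R.deriv_eval_closed[OF fO, of x] xO by simp
  have "?\<rho> ?d = E.deriv_eval (E.Irr ?k \<xi>) \<xi>"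
    using h.deriv_eval_hom[OF _ fO, of x, unfolded map_f, folded \<xi>_def] xO by simp
  then have "v ?d = 0"
    using E.separable_Irr_deriv_eval[OF k \<xi> alg sepx] residue_class_eq_zero_iff[OF dO] by simp
  moreover have "?d \<in> carrier L"
    using dO by (simp add: valuation_ring_def)
  ultimately have "inv ?d \<in> valuation_ring L v" "inv ?d \<otimes> ?d = \<one>"
    using val_inv[of ?d] by (auto simp: valuation_ring_def)
  then have unit: "?d \<in> Units ?O"
    using dO cring.cring_simprules(14)[OF cring_valuation_ring, of "inv ?d" ?d]
    by (auto simp: Units_def intro!: bexI[of _ "inv ?d"])
  show "carrier (kaehler_differentials ?O OK) = {\<zero>\<^bsub>kaehler_differentials ?O OK\<^esub>}"
    using kaehler_differentials_simple_extension[OF cring_valuation_ring OKO _ _ f _ unit]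
      simple_extension_consistent[OF O] gen_O f0 eval_consistent[OF O] xO by simp
qed

theorem theorem4p4:
  fixes L :: "('a, 'm) ring_scheme" and K :: "'a set"
    and v :: "'a \<Rightarrow> 'g::linordered_ab_group_add extended"
  assumes "valued_field L v"
    and "subfield K L"
    and "ring.finite_dimension L K (carrier L)"
    and "ring.separable_extension (residue_field L v)
           (residue_subfield L v K) (carrier (residue_field L v))"
    and "ring.dimension (residue_field L v) (ring.dim L K (carrier L))
           (residue_subfield L v K) (carrier (residue_field L v))"
  shows "(\<exists>x \<in> carrier L.
            valuation_ring L v =
              ring.simple_extension L (valuation_ring (L\<lparr>carrier := K\<rparr>) v) x \<and>
            v x = 0 \<and>
            carrier (residue_field L v) =
              generate_field (residue_field L v)
                (insert (residue_class L v x) (residue_subfield L v K))) \<and>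
         carrier (kaehler_differentials (L\<lparr>carrier := valuation_ring L v\<rparr>)
                    (valuation_ring (L\<lparr>carrier := K\<rparr>) v)) =
           {\<zero>\<^bsub>kaehler_differentials (L\<lparr>carrier := valuation_ring L v\<rparr>)
                    (valuation_ring (L\<lparr>carrier := K\<rparr>) v)\<^esub>}"
proof -
  let ?E = "residue_field L v" and ?k = "residue_subfield L v K"
  interpret valued_field L v
    by (rule assms(1))
  interpret E: field ?E
    by (rule field_residue_field)
  have k: "subfield ?k ?E"
    by (rule subfield_residue_subfield[OF assms(2)])
  have dim: "dimension (ring.dim L K (carrier L)) K (carrier L)"
    using finite_dimensionE[OF assms(2,3)] by (simp add: over_def)
  obtain z where z: "z \<in> carrier ?E" "E.simple_extension ?k z = carrier ?E"
    using E.primitive_element[OF k E.finite_dimensionI[OF assms(5)] assms(4)] .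
  \<comment> \<open>The primitive element may be 0 when the two residue fields coincide; 1 then
    serves as well. A nonzero residue is what forces a lift to have value 0.\<close>
  obtain w where w: "w \<in> carrier ?E" "w \<noteq> \<zero>\<^bsub>?E\<^esub>" "E.simple_extension ?k w = carrier ?E"
  proof (cases "z = \<zero>\<^bsub>?E\<^esub>")
    case True
    have "\<zero>\<^bsub>?E\<^esub> \<in> E.simple_extension ?k \<one>\<^bsub>?E\<^esub>"
      by simp
    then have "E.simple_extension ?k z \<subseteq> E.simple_extension ?k \<one>\<^bsub>?E\<^esub>"
      unfolding True
      using E.simple_extension_subring_incl[OF E.simple_extension_is_subring[OF subfieldE(1)[OF k] E.one_closed]
          E.simple_extension_incl[OF subfieldE(3)[OF k] E.one_closed]] by simp
    then have "E.simple_extension ?k \<one>\<^bsub>?E\<^esub> = carrier ?E"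
      using z(2) E.simple_extension_in_carrier[OF subfieldE(3)[OF k] E.one_closed] by blast
    then show ?thesis
      using that E.one_closed E.one_not_zero by blast
  qed (use that z in blast)
  obtain x where x: "x \<in> valuation_ring L v" "w = residue_class L v x"
    using w(1) residue_class_surj by auto
  then have vx: "x \<in> carrier L" "v x = 0"
    using residue_class_eq_zero_iff w(2) by (auto simp: valuation_ring_def)
  note result = unramified_simple_extension[OF assms(2) dim vx w(3)[unfolded x(2)] assms(4,5)]
  let ?G = "generate_field ?E (insert w ?k)"
  have sub: "insert w ?k \<subseteq> carrier ?E"
    using w(1) subfieldE(3)[OF k] by simp
  have "subring ?G ?E"
    by (rule subfieldE(1)[OF E.generate_field_is_subfield[OF sub]])
  moreover have "insert w ?k \<subseteq> ?G"
    using generate_field.incl[of _ "insert w ?k" ?E] by blast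
  \<comment> \<open>The generated field is a subring containing the residue of \<open>x\<close> and
    the residue field of \<open>K\<close>, hence it contains the simple extension, which is already
    everything.\<close>
  ultimately have "carrier ?E = ?G"
    using E.simple_extension_subring_incl[of ?G ?k w] w(3) E.generate_field_in_carrier[OF sub] by auto
  then show ?thesis
    using vx result x(2) by blast
qed

end
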